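(* For every $n\geq 0$ and every $\alpha\in\mathcal{E}_q(n)$, the vector $v_\alpha\in\mathbb{C}[B_q(n)]$ satisfies (i) $\mathcal{A}_q(n)(v_\alpha)=\big((n-k)_q-(k)_q\big)v_\alpha$, where $k=N(\alpha)$; and (ii) $\{v_\alpha:\alpha\in\mathcal{E}_q(n)\}$ is a basis of $\mathbb{C}[B_q(n)]$.
   Context: $q$ is a prime power and $(m)_q=1+q+\cdots+q^{m-1}$ for $m\geq0$. For $m\geq 0$, $\mathbb{F}_q^m$ is the space of column vectors of length $m$ over $\mathbb{F}_q$ with standard basis $e_1,\dots,e_m$; for $k<m$, $\mathbb{F}_q^k$ is identified with the subspace of vectors whose last $m-k$ coordinates vanish. $B_q(m)$ is the set of subspaces of $\mathbb{F}_q^m$; $B_q(X)$ is the set of subspaces of a space $X$. $\mathbb{C}[S]$ is the complex vector space with basis $S$; so $\mathbb{C}[B_q(m)]\subseteq\mathbb{C}[B_q(m+1)]$. $Z'$ covers $Z$ means $Z\subseteq Z'$, $\dim Z'=\dim Z+1$. $\mathcal{A}_q(m)$ is the linear operator on $\mathbb{C}[B_q(m)]$ with $\mathcal{A}_q(m)(Z)=\sum_{Z'\text{ covers }Z}Z'+q^{\dim Z-1}\sum_{Z\text{ covers }Z'}Z'$. Construction. Let $n\geq0$. $A_q(n+1)=\{Y\in B_q(n+1):Y\not\subseteq\mathbb{F}_q^n\}$. $\theta_n:\mathbb{C}[B_q(n)]\to\mathbb{C}[B_q(n+1)]$ is linear with $\theta_n(Z)=\sum Y$ over all $Y\in A_q(n+1)$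 with $Y\cap\mathbb{F}_q^n=Z$. For $Z\in B_q(n)$, $\widehat Z$ is the span of $Z$ and $e_{n+1}$. $H(n+1,\mathbb{F}_q)$ is the group of matrices $\begin{pmatrix}I_n&a\\0&1\end{pmatrix}$, $a\in\mathbb{F}_q^n$, acting on $A_q(n+1)$ by $Y\mapsto gY$ and linearly on $\mathbb{C}[A_q(n+1)]$. $\mathcal{N}_q(n)$ is the set of nontrivial homomorphisms $\chi:H(n+1,\mathbb{F}_q)\to\mathbb{C}^*$, and $p(\chi)(v)=\sum_g\overline{\chi(g)}\,gv$. It is a fact that for $n\geq1$, $\chi\in\mathcal{N}_q(n)$ there is a unique $(n-1)$-dimensional $X(\chi)\subseteq\mathbb{F}_q^n$ with $p(\chi)(\widehat{X(\chi)})\neq0$; $\lambda(\chi):\mathbb{C}[B_q(X(\chi))]\to\mathbb{C}[B_q(n+1)]$ is linear with $Y\mapsto q^{-\dim Y}p(\chi)(\widehat Y)$. For an $(n-1)$-dimensional $X\subseteq\mathbb{F}_q^n$, $M(X)$ is the unique $n\times(n-1)$ matrix in Schubert normal form (every column nonzero; last nonzero entry of column $j$ is $1$, in row $r_j$; $r_1<\dots<r_{n-1}$; rows $r_1,\dots,r_{n-1}$ form the identity) with column space $X$; $\tau(X):\mathbb{F}_q^{n-1}\to X$ sends $e_j$ to column $j$ of $M(X)$; $\mu(X):\mathbb{C}[B_q(n-1)]\to\mathbb{C}[B_q(X)]$ is $Y\mapsto\tau(X)(Y)$. Index sets: $\mathcal{E}_q(0)=\{()\}$, $\mathcal{E}_q(1)=\{(0),(1)\}$,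 and for $n\geq2$, $\mathcal{E}_q(n)$ consists of the sequences $(\beta,0),(\beta,1)$ with $\beta\in\mathcal{E}_q(n-1)$ together with the sequences $(\beta,\chi)$ with $\beta\in\mathcal{E}_q(n-2)$, $\chi\in\mathcal{N}_q(n-1)$ (here $(\beta,a)$ is $\beta$ with $a$ appended). $N(\alpha)$ is the number of entries of $\alpha$ not equal to $0$. Vectors: $v_{()}=\{0\}$, $v_{(0)}=\{0\}+\mathbb{F}_q$, $v_{(1)}=\{0\}-\mathbb{F}_q$. For $n\geq1$ and $\alpha=(\beta,a)\in\mathcal{E}_q(n+1)$ with $k=N(\beta)$: if $a=0$, $v_\alpha=q^kv_\beta+\theta_n(v_\beta)$; if $a=1$, $v_\alpha=q^{n-k}v_\beta-\theta_n(v_\beta)$; if $a=\chi\in\mathcal{N}_q(n)$ (so $\beta\in\mathcal{E}_q(n-1)$), $v_\alpha=\lambda(\chi)\big(\mu(X(\chi))(v_\beta)\big)$. *)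

theory Defs
  imports Complex_Main "HOL-Library.Cardinality" "HOL-Library.Function_Algebras"
    "HOL-Algebra.Group"
begin

text \<open>
  The field with \<open>q\<close> elements is a type \<open>'a :: {field, finite}\<close>, with \<open>q = CARD('a)\<close>.
  Both the spaces of column vectors over it and the complex vector spaces freely generated by
  sets of subspaces are realised as function spaces with pointwise operations, so one
  vector space interpretation serves both.
\<close>

definition fscale :: "'b::field \<Rightarrow> ('i \<Rightarrow> 'b) \<Rightarrow> 'i \<Rightarrow> 'b" where
  "fscale c f = (\<lambda>i. c * f i)"

global_interpretation fs: vector_space "fscale :: 'b::field \<Rightarrow> ('i \<Rightarrow> 'b) \<Rightarrow> 'i \<Rightarrow> 'b"
  by standard (simp_all add: fscale_def fun_eq_iff plus_fun_def algebra_simps)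

subsection \<open>Free complex vector spaces\<close>

definition free_space :: "'s set \<Rightarrow> ('s \<Rightarrow> complex) set" where
  "free_space S = {f. finite {s. f s \<noteq> 0} \<and> {s. f s \<noteq> 0} \<subseteq> S}"

definition basis_vec :: "'s \<Rightarrow> 's \<Rightarrow> complex" where
  "basis_vec s = (\<lambda>t. if t = s then 1 else 0)"

text \<open>The linear map on \<open>free_space S\<close> given by \<open>\<phi>\<close> on the basis \<open>S\<close>; every \<open>S\<close> below is finite.\<close>

definition lin_ext :: "'s set \<Rightarrow> ('s \<Rightarrow> 't \<Rightarrow> complex) \<Rightarrow> ('s \<Rightarrow> complex) \<Rightarrow> 't \<Rightarrow> complex" where
  "lin_ext S \<phi> f = (\<Sum>s\<in>S. fscale (f s) (\<phi> s))"

subsection \<open>Vectors, matrices and subspaces over the finite field\<close>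

text \<open>
  Coordinates are numbered from \<open>0\<close>, and vectors of length \<open>m\<close> are continued by zero, which makes
  the embedding of the vectors of length \<open>k < m\<close> into those of length \<open>m\<close> a literal inclusion.
\<close>

type_synonym 'a fvec = "nat \<Rightarrow> 'a"
type_synonym 'a fmat = "nat \<Rightarrow> nat \<Rightarrow> 'a"

definition vecs :: "nat \<Rightarrow> 'a::{field,finite} fvec set" where
  "vecs m = {v. \<forall>i\<ge>m. v i = 0}"

text \<open>\<open>unit_vec n\<close> is the standard basis vector usually written with index \<open>n + 1\<close>.\<close>

definition unit_vec :: "nat \<Rightarrow> 'a::{field,finite} fvec" where
  "unit_vec n = (\<lambda>i. if i = n then 1 else 0)"

definition mats :: "nat \<Rightarrow> nat \<Rightarrow> 'a::{field,finite} fmat set" where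
  "mats r c = {M. \<forall>i j. \<not> (i < r \<and> j < c) \<longrightarrow> M i j = 0}"

definition mat_mul :: "nat \<Rightarrow> 'a::{field,finite} fmat \<Rightarrow> 'a fmat \<Rightarrow> 'a fmat" where
  "mat_mul m M N = (\<lambda>i j. \<Sum>k<m. M i k * N k j)"

definition mat_vec :: "nat \<Rightarrow> 'a::{field,finite} fmat \<Rightarrow> 'a fvec \<Rightarrow> 'a fvec" where
  "mat_vec c M v = (\<lambda>i. \<Sum>j<c. M i j * v j)"

definition subspaces_of :: "'a::{field,finite} fvec set \<Rightarrow> 'a fvec set set" where
  "subspaces_of X = {Z. fs.subspace Z \<and> Z \<subseteq> X}"

definition Bq :: "nat \<Rightarrow> 'a::{field,finite} fvec set set" where
  "Bq m = subspaces_of (vecs m)"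

definition covers :: "'a::{field,finite} fvec set \<Rightarrow> 'a fvec set \<Rightarrow> bool" where
  "covers Z' Z \<longleftrightarrow> Z \<subseteq> Z' \<and> fs.dim Z' = fs.dim Z + 1"

definition qnum :: "complex \<Rightarrow> nat \<Rightarrow> complex" where
  "qnum q m = (\<Sum>i<m. q ^ i)"

text \<open>
  The zero space covers nothing, so the truncated exponent \<open>dim Z - 1\<close> is only
  relevant for \<open>dim Z \<ge> 1\<close>.
\<close>

definition Aop :: "nat \<Rightarrow> ('a::{field,finite} fvec set \<Rightarrow> complex) \<Rightarrow> 'a fvec set \<Rightarrow> complex" where
  "Aop m = lin_ext (Bq m) (\<lambda>Z.
     (\<Sum>Z'\<in>{Z'\<in>Bq m. covers Z' Z}. basis_vec Z') +
     fscale (of_nat CARD('a) ^ (fs.dim Z - 1)) (\<Sum>Z'\<in>{Z'\<in>Bq m. covers Z Z'}. basis_vec Z'))"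

subsection \<open>Affine subspaces, the unipotent group and its characters\<close>

text \<open>\<open>Aff n\<close>, \<open>Hmat n\<close> and \<open>Hgrp n\<close> live in dimension \<open>n + 1\<close>.\<close>

definition Aff :: "nat \<Rightarrow> 'a::{field,finite} fvec set set" where
  "Aff n = {Y \<in> Bq (n + 1). \<not> Y \<subseteq> vecs n}"

definition theta :: "nat \<Rightarrow> ('a::{field,finite} fvec set \<Rightarrow> complex) \<Rightarrow> 'a fvec set \<Rightarrow> complex" where
  "theta n = lin_ext (Bq n) (\<lambda>Z. \<Sum>Y\<in>{Y\<in>Aff n. Y \<inter> vecs n = Z}. basis_vec Y)"

definition hat :: "nat \<Rightarrow> 'a::{field,finite} fvec set \<Rightarrow> 'a fvec set" where
  "hat n Z = fs.span (insert (unit_vec n) Z)"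

definition Hmat :: "nat \<Rightarrow> 'a::{field,finite} fvec \<Rightarrow> 'a fmat" where
  "Hmat n a = (\<lambda>i j. if i \<le> n \<and> i = j then 1 else if i < n \<and> j = n then a i else 0)"

definition Hgrp :: "nat \<Rightarrow> 'a::{field,finite} fmat monoid" where
  "Hgrp n = \<lparr>carrier = Hmat n ` vecs n, mult = mat_mul (n + 1), one = Hmat n 0\<rparr>"

definition Cstar :: "complex monoid" where
  "Cstar = \<lparr>carrier = - {0}, mult = (*), one = 1\<rparr>"

text \<open>
  Homomorphisms are maps defined on the group only, so they are taken to be \<open>undefined\<close>
  outside the carrier; otherwise one character would be represented by several functions.
\<close>

definition Nchars :: "nat \<Rightarrow> ('a::{field,finite} fmat \<Rightarrow> complex) set" where
  "Nchars n = {\<chi> \<in> hom (Hgrp n) Cstar \<inter> extensional (carrier (Hgrp n)).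
                 \<exists>g\<in>carrier (Hgrp n). \<chi> g \<noteq> 1}"

definition act :: "nat \<Rightarrow> 'a::{field,finite} fmat
    \<Rightarrow> ('a fvec set \<Rightarrow> complex) \<Rightarrow> 'a fvec set \<Rightarrow> complex" where
  "act n g = lin_ext (Aff n) (\<lambda>Y. basis_vec (mat_vec (n + 1) g ` Y))"

definition pchi :: "nat \<Rightarrow> ('a::{field,finite} fmat \<Rightarrow> complex)
    \<Rightarrow> ('a fvec set \<Rightarrow> complex) \<Rightarrow> 'a fvec set \<Rightarrow> complex" where
  "pchi n \<chi> v = (\<Sum>g\<in>carrier (Hgrp n). fscale (cnj (\<chi> g)) (act n g v))"

definition Xchi :: "nat \<Rightarrow> ('a::{field,finite} fmat \<Rightarrow> complex) \<Rightarrow> 'a fvec set" where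
  "Xchi n \<chi> = (THE X. X \<in> Bq n \<and> fs.dim X = n - 1 \<and> pchi n \<chi> (basis_vec (hat n X)) \<noteq> 0)"

definition lambda :: "nat \<Rightarrow> ('a::{field,finite} fmat \<Rightarrow> complex)
    \<Rightarrow> ('a fvec set \<Rightarrow> complex) \<Rightarrow> 'a fvec set \<Rightarrow> complex" where
  "lambda n \<chi> = lin_ext (subspaces_of (Xchi n \<chi>))
     (\<lambda>Y. fscale (1 / of_nat CARD('a) ^ fs.dim Y) (pchi n \<chi> (basis_vec (hat n Y))))"

subsection \<open>Schubert normal form\<close>

definition schubert_nf :: "nat \<Rightarrow> nat \<Rightarrow> 'a::{field,finite} fmat \<Rightarrow> bool" where
  "schubert_nf n m M \<longleftrightarrow> M \<in> mats n m \<and>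
     (\<exists>r. strict_mono_on {..<m} r \<and>
       (\<forall>j<m. r j < n \<and> M (r j) j = 1 \<and> (\<forall>i. r j < i \<and> i < n \<longrightarrow> M i j = 0)) \<and>
       (\<forall>j<m. \<forall>j'<m. M (r j) j' = (if j = j' then 1 else 0)))"

definition column_space :: "nat \<Rightarrow> 'a::{field,finite} fmat \<Rightarrow> 'a fvec set" where
  "column_space m M = fs.span {(\<lambda>i. M i j) |j. j < m}"

definition Mmat :: "nat \<Rightarrow> 'a::{field,finite} fvec set \<Rightarrow> 'a fmat" where
  "Mmat n X = (THE M. schubert_nf n (n - 1) M \<and> column_space (n - 1) M = X)"

definition tau :: "nat \<Rightarrow> 'a::{field,finite} fvec set \<Rightarrow> 'a fvec \<Rightarrow> 'a fvec" where
  "tau n X = mat_vec (n - 1) (Mmat n X)"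

definition mu :: "nat \<Rightarrow> 'a::{field,finite} fvec set
    \<Rightarrow> ('a fvec set \<Rightarrow> complex) \<Rightarrow> 'a fvec set \<Rightarrow> complex" where
  "mu n X = lin_ext (Bq (n - 1)) (\<lambda>Y. basis_vec (tau n X ` Y))"

subsection \<open>Index sequences and the vectors attached to them\<close>

datatype 'a entry = Ent0 | Ent1 | EntChi "'a fmat \<Rightarrow> complex"

fun Eq :: "nat \<Rightarrow> 'a::{field,finite} entry list set" where
  "Eq 0 = {[]}"
| "Eq (Suc 0) = {[Ent0], [Ent1]}"
| "Eq (Suc (Suc m)) =
     {\<beta> @ [a] |\<beta> a. \<beta> \<in> Eq (Suc m) \<and> a \<in> {Ent0, Ent1}} \<union>
     {\<beta> @ [EntChi \<chi>] |\<beta> \<chi>. \<beta> \<in> Eq m \<and> \<chi> \<in> Nchars (Suc m)}"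

definition Nnz :: "'a entry list \<Rightarrow> nat" where
  "Nnz \<alpha> = length (filter (\<lambda>a. a \<noteq> Ent0) \<alpha>)"

text \<open>
  \<open>vvec n \<alpha>\<close> is meaningful for \<open>\<alpha> \<in> Eq n\<close>; the last equation is the recursive step from
  \<open>n = m + 1\<close> (or from \<open>m = n - 1\<close>, for a character) to \<open>n + 1\<close>.
\<close>

fun vvec :: "nat \<Rightarrow> 'a::{field,finite} entry list \<Rightarrow> 'a fvec set \<Rightarrow> complex" where
  "vvec 0 \<alpha> = basis_vec {0}"
| "vvec (Suc 0) \<alpha> =
     (if \<alpha> = [Ent0] then basis_vec {0} + basis_vec (vecs 1)
      else basis_vec {0} - basis_vec (vecs 1))"
| "vvec (Suc (Suc m)) \<alpha> =
     (let n = Suc m; \<beta> = butlast \<alpha>; k = Nnz \<beta>; q = of_nat CARD('a) in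
      case last \<alpha> of
        Ent0 \<Rightarrow> fscale (q ^ k) (vvec n \<beta>) + theta n (vvec n \<beta>)
      | Ent1 \<Rightarrow> fscale (q ^ (n - k)) (vvec n \<beta>) - theta n (vvec n \<beta>)
      | EntChi \<chi> \<Rightarrow> lambda n \<chi> (mu n (Xchi n \<chi>) (vvec m \<beta>)))"

end

theory Submission
  imports Defs
begin

text \<open>
  Fix a nontrivial additive character \<open>\<psi>\<close> of the field. The characters of \<open>H(n + 1)\<close> are then
  \<open>a \<mapsto> \<psi> (u \<bullet> a)\<close> for \<open>u \<in> vecs n\<close>, and the hyperplane attached to a nontrivial one is the
  orthogonal complement \<open>perp n u\<close>. Every subspace not contained in \<open>vecs n\<close> has the form
  \<open>Z + \<langle>e + a\<rangle>\<close> with \<open>e = unit_vec n\<close>, and with \<open>L\<^sub>u c (Z + \<langle>e + a\<rangle>) = \<psi> (- u \<bullet> a) c Z\<close> one has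
  \<open>theta n = L\<^sub>0\<close> and \<open>lambda n \<chi>\<^sub>u = L\<^sub>u\<close>. Both kinds of recursion steps thus follow from the identities
  \<open>A (L\<^sub>u c) = q L\<^sub>u (A c) + (if u = 0 then q\<^sup>n else 0) c\<close> and \<open>A\<^sub>n\<^sub>+\<^sub>1 f = A\<^sub>n f + L\<^sub>0 f\<close>, and the basis property
  from the decomposition of the whole space into the functions on subspaces of \<open>vecs n\<close> and the
  images of all the \<open>L\<^sub>u\<close>; that decomposition is the orthogonality of characters.
\<close>

text \<open>In \<open>Z + \<langle>e + a\<rangle>\<close> the vector \<open>a\<close> is determined
  only modulo \<open>Z\<close>. So \<open>L\<^sub>u c\<close> makes sense only if \<open>c\<close>
  is supported on the subspaces of \<open>perp n u\<close>, where the phase does not depend on the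
  choice of \<open>a\<close>. This is why a nontrivial character takes its input from dimension n -
  1, and why such an entry raises the dimension by two. For \<open>u = 0\<close> there is no such
  restriction, and \<open>c\<close> and \<open>L\<^sub>0 c\<close> become coupled. If
  \<open>v\<close> is an eigenvector in dimension n with eigenvalue t = (n-k)_q - (k)_q, the
  operator maps v to t v + L v and L v to q t L v + q^n v, where L is \<open>L\<^sub>0\<close>.
  Hence s v + L v is an eigenvector, with eigenvalue s + q t, exactly when s^2 + (q - 1) t s = q^n.
  As (q - 1) t = q^(n-k) - q^k, the roots are s = q^k and s = -q^(n-k): these are the coefficients
  in the steps for the entries 0 and 1. The roots have opposite signs, so the two eigenvectors span
  the same plane as v and L v. For \<open>u \<noteq> 0\<close> the extra term vanishes by
  cancellation of phases, and the eigenvalue is just multiplied by q.\<close>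

section \<open>Linear extension on free complex vector spaces\<close>

lemma fscale_apply: "fscale c f i = c * f i"
  by (simp add: fscale_def)

lemma sum_fun_apply: "(\<Sum>s\<in>S. \<phi> s) t = (\<Sum>s\<in>S. \<phi> s t)"
  by (induction S rule: infinite_finite_induct) auto

lemma lin_ext_apply: "lin_ext S \<phi> f t = (\<Sum>s\<in>S. f s * \<phi> s t)"
  by (simp add: lin_ext_def sum_fun_apply fscale_apply)

lemma sum_basis_vec: "finite S \<Longrightarrow> (\<Sum>s\<in>S. basis_vec s) t = (if t \<in> S then 1 else 0)"
  by (simp add: sum_fun_apply basis_vec_def)

lemma lin_ext_basis_vec: "finite S \<Longrightarrow> s \<in> S \<Longrightarrow> lin_ext S \<phi> (basis_vec s) = \<phi> s"
  by (auto simp: fun_eq_iff lin_ext_apply basis_vec_def if_distrib[of "\<lambda>x. x * _"] cong: if_cong)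

lemma lin_ext_add: "lin_ext S \<phi> (f + g) = lin_ext S \<phi> f + lin_ext S \<phi> g"
  by (simp add: fun_eq_iff lin_ext_apply sum.distrib algebra_simps)

lemma lin_ext_scale: "lin_ext S \<phi> (fscale c f) = fscale c (lin_ext S \<phi> f)"
  by (simp add: fun_eq_iff lin_ext_apply fscale_apply sum_distrib_left algebra_simps)

lemma lin_ext_sum: "lin_ext S \<phi> (\<Sum>i\<in>I. f i) = (\<Sum>i\<in>I. lin_ext S \<phi> (f i))"
proof (induction I rule: infinite_finite_induct)
  case (insert i I)
  then show ?case by (simp only: sum.insert lin_ext_add not_False_eq_True)
qed (simp_all add: fun_eq_iff lin_ext_apply)

lemma free_space_iff: "finite S \<Longrightarrow> f \<in> free_space S \<longleftrightarrow> (\<forall>s. s \<notin> S \<longrightarrow> f s = 0)"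
  by (auto simp: free_space_def intro: finite_subset)

lemma basis_vec_free_space: "s \<in> S \<Longrightarrow> basis_vec s \<in> free_space S"
  by (auto simp: free_space_def basis_vec_def)

lemma free_space_expansion:
  assumes "finite S" "f \<in> free_space S"
  shows "f = (\<Sum>s\<in>S. fscale (f s) (basis_vec s))"
proof
  fix t
  have "(\<Sum>s\<in>S. fscale (f s) (basis_vec s)) t = (\<Sum>s\<in>S. if t = s then f s else 0)"
    unfolding sum_fun_apply by (rule sum.cong) (auto simp: basis_vec_def fscale_apply)
  then show "f t = (\<Sum>s\<in>S. fscale (f s) (basis_vec s)) t"
    using assms by (simp add: free_space_iff)
qed

lemma subspace_free_space: "fs.subspace (free_space S)"
  unfolding fs.subspace_def
proof (intro conjI ballI allI)
  show "0 \<in> free_space S" by (simp add: free_space_def)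
next
  fix f g :: "'a \<Rightarrow> complex" assume "f \<in> free_space S" "g \<in> free_space S"
  moreover have "{s. (f + g) s \<noteq> 0} \<subseteq> {s. f s \<noteq> 0} \<union> {s. g s \<noteq> 0}" by auto
  ultimately show "f + g \<in> free_space S"
    by (auto simp: free_space_def elim!: finite_subset)
next
  fix c and f :: "'a \<Rightarrow> complex" assume "f \<in> free_space S"
  moreover have "{s. fscale c f s \<noteq> 0} \<subseteq> {s. f s \<noteq> 0}" by (auto simp: fscale_apply)
  ultimately show "fscale c f \<in> free_space S"
    by (auto simp: free_space_def elim!: finite_subset)
qed

section \<open>Finite vector spaces\<close>

lemma subspace_vecs: "fs.subspace (vecs n)"
  by (auto simp: fs.subspace_def vecs_def fscale_apply)

lemma vecs_0: "vecs 0 = {0}"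
  by (auto simp: vecs_def fun_eq_iff)

lemma vecs_mono: "m \<le> n \<Longrightarrow> vecs m \<subseteq> vecs n"
  by (auto simp: vecs_def)

lemma finite_vecs [simp]: "finite (vecs n :: 'a::{field,finite} fvec set)"
proof (induction n)
  case 0 then show ?case by (simp add: vecs_0)
next
  case (Suc n)
  have "vecs (Suc n) \<subseteq> (\<lambda>(v, a). v(n := a)) ` (vecs n \<times> (UNIV :: 'a set))"
  proof
    fix x :: "'a fvec" assume "x \<in> vecs (Suc n)"
    then have "x(n := 0) \<in> vecs n"
      by (auto simp: vecs_def)
    then show "x \<in> (\<lambda>(v, a). v(n := a)) ` (vecs n \<times> (UNIV :: 'a set))"
      by (intro image_eqI[where x = "(x(n := 0), x n)"]) auto
  qed
  then show ?case
    using Suc by (auto intro: finite_subset)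
qed

lemma Bq_iff: "Z \<in> Bq n \<longleftrightarrow> fs.subspace Z \<and> Z \<subseteq> vecs n"
  by (simp add: Bq_def subspaces_of_def)

lemma finite_subspaces_of [simp]: "X \<subseteq> vecs n \<Longrightarrow> finite (subspaces_of X)"
  by (rule finite_subset[of _ "Pow X"]) (auto simp: subspaces_of_def intro: finite_subset[OF _ finite_vecs])

lemma finite_Bq [simp]: "finite (Bq n)"
  unfolding Bq_def by (rule finite_subspaces_of) (rule subset_refl)

lemma finite_Aff [simp]: "finite (Aff n)"
  unfolding Aff_def by simp

lemma Bq_finite: "Z \<in> Bq n \<Longrightarrow> finite Z"
  by (auto simp: Bq_iff intro: finite_subset)

lemma card_Bq_pos: "Z \<in> Bq n \<Longrightarrow> card Z > 0"
  using Bq_finite[of Z n] fs.subspace_0[of Z] by (auto simp: Bq_iff card_gt_0_iff)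

text \<open>Adjoining \<open>b\<close> multiplies the size by that of the field: the coefficient of
  \<open>b\<close> in an element is unique, since otherwise \<open>b\<close> would lie in
  \<open>fs.span B\<close>.\<close>

lemma card_span:
  assumes "finite B" "fs.independent B"
  shows "finite (fs.span B) \<and> card (fs.span B :: 'a::{field,finite} fvec set) = CARD('a) ^ card B"
  using assms
proof (induction B rule: finite_induct)
  case empty
  then show ?case by simp
next
  case (insert b B)
  let ?f = "\<lambda>(k, x). fscale k b + x"
  have b: "b \<notin> fs.span B" and B: "fs.independent B"
    using insert by (auto simp: fs.independent_insert)
  have img: "fs.span (insert b B) = ?f ` (UNIV \<times> fs.span B)"
  proof (intro equalityI subsetI)
    fix x assume "x \<in> fs.span (insert b B)"
    then obtain k where k: "x - fscale k b \<in> fs.span B"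
      by (auto simp: fs.span_insert)
    then show "x \<in> ?f ` (UNIV \<times> fs.span B)"
      by (intro image_eqI[where x = "(k, x - fscale k b)"]) auto
  next
    fix x assume "x \<in> ?f ` (UNIV \<times> fs.span B)"
    then obtain k y where x: "x = fscale k b + y" "y \<in> fs.span B"
      by auto
    then have "x - fscale k b \<in> fs.span B"
      by simp
    then show "x \<in> fs.span (insert b B)"
      by (auto simp: fs.span_insert)
  qed
  have inj: "inj_on ?f (UNIV \<times> fs.span B)"
  proof (rule inj_onI, clarify)
    fix k x l y
    assume x: "x \<in> fs.span B" "y \<in> fs.span B" "fscale k b + x = fscale l b + y"
    then have "fscale (k - l) b = y - x"
      by (simp add: fs.scale_left_diff_distrib algebra_simps)
    then have "fscale (k - l) b \<in> fs.span B"
      using x by (simp add: fs.span_diff)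
    moreover have "k \<noteq> l \<Longrightarrow> b = fscale (1 / (k - l)) (fscale (k - l) b)"
      by simp
    ultimately have "k = l"
      using b fs.span_scale by metis
    then show "k = l \<and> x = y" using x by simp
  qed
  have "card (fs.span (insert b B)) = CARD('a) * card (fs.span B)"
    unfolding img card_image[OF inj] by (simp add: card_cartesian_product)
  moreover have "finite (fs.span (insert b B))"
    unfolding img using insert B by auto
  ultimately show ?case
    using insert B by simp
qed

lemma card_eq_power_dim:
  fixes Z :: "'a::{field,finite} fvec set"
  assumes "fs.subspace Z" "finite Z"
  shows "card Z = CARD('a) ^ fs.dim Z"
proof -
  obtain B where B: "B \<subseteq> Z" "fs.independent B" "Z \<subseteq> fs.span B" "card B = fs.dim Z"
    using fs.basis_exists by metis
  have "fs.span B = Z"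
    using B assms by (simp add: fs.span_minimal subset_antisym)
  then show ?thesis
    using card_span[of B] B assms finite_subset by metis
qed

lemma CARD_ge_2: "CARD('a::{field,finite}) \<ge> 2"
proof -
  have "card {0, 1::'a} \<le> CARD('a)" by (rule card_mono) auto
  then show ?thesis by simp
qed

text \<open>Turns the dimension condition into a count, so that no bases are needed later. The two
  ambient dimensions may differ, which allows a subspace of \<open>vecs n\<close> to be compared
  with one of \<open>vecs (Suc n)\<close>.\<close>

lemma covers_iff_card:
  fixes Z Z' :: "'a::{field,finite} fvec set"
  assumes "Z \<in> Bq m" "Z' \<in> Bq n"
  shows "covers Z' Z \<longleftrightarrow> Z \<subseteq> Z' \<and> card Z' = CARD('a) * card Z"
proof -
  have "CARD('a) ^ fs.dim Z' = CARD('a) ^ (fs.dim Z + 1) \<longleftrightarrow> fs.dim Z' = fs.dim Z + 1"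
    using CARD_ge_2[where 'a='a] by (intro power_inject_exp) simp
  moreover have "card Z = CARD('a) ^ fs.dim Z" "card Z' = CARD('a) ^ fs.dim Z'"
    using assms Bq_finite[OF assms(1)] Bq_finite[OF assms(2)]
    by (auto simp: Bq_iff intro!: card_eq_power_dim)
  ultimately show ?thesis
    by (simp add: covers_def)
qed

section \<open>Affine subspaces\<close>

text \<open>Equals the span of \<open>Z\<close> and \<open>unit_vec n + a\<close> whenever \<open>Z\<close> is a subspace of \<open>vecs n\<close> and
  \<open>a \<in> vecs n\<close>, because coordinate \<open>n\<close> then determines the coefficient of \<open>unit_vec n + a\<close>.\<close>

definition affine_ext :: "nat \<Rightarrow> 'a::{field,finite} fvec set \<Rightarrow> 'a fvec \<Rightarrow> 'a fvec set" where
  "affine_ext n Z a = {x. x - fscale (x n) (unit_vec n + a) \<in> Z}"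

lemma unit_vec_plus_nth: "a \<in> vecs n \<Longrightarrow> (unit_vec n + a) n = 1"
  by (simp add: unit_vec_def vecs_def)

lemma unit_vec_plus_mem_affine_ext:
  assumes "a \<in> vecs n"
  shows "unit_vec n + a \<in> affine_ext n Z b \<longleftrightarrow> a - b \<in> Z"
proof -
  have "unit_vec n + a - fscale 1 (unit_vec n + b) = a - b"
    by simp
  then show ?thesis
    using assms by (simp only: affine_ext_def mem_Collect_eq unit_vec_plus_nth)
qed

lemma affine_ext_subspace:
  assumes "fs.subspace Z"
  shows "fs.subspace (affine_ext n Z a)"
  unfolding fs.subspace_def
proof (intro conjI ballI allI)
  show "0 \<in> affine_ext n Z a"
    using fs.subspace_0[OF assms] by (simp add: affine_ext_def)
next
  fix x y assume "x \<in> affine_ext n Z a" "y \<in> affine_ext n Z a"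
  moreover have "x + y - fscale ((x + y) n) (unit_vec n + a) =
    (x - fscale (x n) (unit_vec n + a)) + (y - fscale (y n) (unit_vec n + a))"
    by (auto simp: fun_eq_iff fscale_apply algebra_simps)
  ultimately show "x + y \<in> affine_ext n Z a"
    using fs.subspace_add[OF assms] by (simp only: affine_ext_def mem_Collect_eq)
next
  fix x c assume "x \<in> affine_ext n Z a"
  moreover have "fscale c x - fscale (fscale c x n) (unit_vec n + a) =
    fscale c (x - fscale (x n) (unit_vec n + a))"
    by (auto simp: fun_eq_iff fscale_apply algebra_simps)
  ultimately show "fscale c x \<in> affine_ext n Z a"
    using fs.subspace_scale[OF assms] by (simp only: affine_ext_def mem_Collect_eq)
qed

lemma affine_ext_vecs:
  assumes "Z \<subseteq> vecs n" "a \<in> vecs n"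
  shows "affine_ext n Z a \<subseteq> vecs (Suc n)"
proof
  fix x assume "x \<in> affine_ext n Z a"
  then have "x - fscale (x n) (unit_vec n + a) \<in> vecs n"
    using assms by (auto simp: affine_ext_def)
  then have "(x - fscale (x n) (unit_vec n + a)) i = 0" if "i \<ge> Suc n" for i
    using that unfolding vecs_def mem_Collect_eq by (metis Suc_leD)
  moreover have "a i = 0" if "i \<ge> Suc n" for i
    using that assms(2) unfolding vecs_def mem_Collect_eq by (metis Suc_leD)
  ultimately show "x \<in> vecs (Suc n)"
    by (simp add: vecs_def unit_vec_def fscale_apply)
qed

lemma unit_vec_plus_mem_affine_ext_self:
  assumes "Z \<in> Bq n" "a \<in> vecs n"
  shows "unit_vec n + a \<in> affine_ext n Z a"
  using assms by (subst unit_vec_plus_mem_affine_ext) (auto simp: Bq_iff fs.subspace_0)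

lemma affine_ext_in_Aff:
  assumes "Z \<in> Bq n" "a \<in> vecs n"
  shows "affine_ext n Z a \<in> Aff n"
proof -
  have "unit_vec n + a \<in> affine_ext n Z a"
    by (intro unit_vec_plus_mem_affine_ext_self assms)
  moreover have "unit_vec n + a \<notin> vecs n"
    using unit_vec_plus_nth[OF assms(2)] by (force simp: vecs_def)
  ultimately show ?thesis
    using assms affine_ext_subspace[of Z] affine_ext_vecs[of Z n a]
    by (auto simp: Aff_def Bq_iff)
qed

lemma affine_ext_Int_vecs:
  assumes "Z \<in> Bq n"
  shows "affine_ext n Z a \<inter> vecs n = Z"
proof -
  have "x \<in> affine_ext n Z a \<longleftrightarrow> x \<in> Z" if "x \<in> vecs n" for x
  proof -
    have "x n = 0" using that by (simp add: vecs_def)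
    then show ?thesis by (simp add: affine_ext_def)
  qed
  then show ?thesis
    using assms by (auto simp: Bq_iff)
qed

text \<open>Forwards, test the vector \<open>unit_vec n + a\<close> and intersect with
  \<open>vecs n\<close>. Backwards, replacing \<open>a\<close> by \<open>b\<close> changes the
  residue by a multiple of \<open>a - b\<close>, which \<open>W\<close> absorbs.\<close>

lemma affine_ext_subset_iff:
  assumes "Z \<in> Bq n" "W \<in> Bq n" "a \<in> vecs n"
  shows "affine_ext n Z a \<subseteq> affine_ext n W b \<longleftrightarrow> Z \<subseteq> W \<and> a - b \<in> W"
proof
  assume *: "affine_ext n Z a \<subseteq> affine_ext n W b"
  have "unit_vec n + a \<in> affine_ext n Z a"
    by (intro unit_vec_plus_mem_affine_ext_self assms)
  with * have "a - b \<in> W"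
    using unit_vec_plus_mem_affine_ext[OF assms(3)] by blast
  then show "Z \<subseteq> W \<and> a - b \<in> W"
    using * affine_ext_Int_vecs[OF assms(1), of a] affine_ext_Int_vecs[OF assms(2), of b] by auto
next
  assume *: "Z \<subseteq> W \<and> a - b \<in> W"
  have W: "fs.subspace W" using assms by (simp add: Bq_iff)
  show "affine_ext n Z a \<subseteq> affine_ext n W b"
  proof
    fix x assume "x \<in> affine_ext n Z a"
    then have "x - fscale (x n) (unit_vec n + a) + fscale (x n) (a - b) \<in> W"
      using * W by (intro fs.subspace_add fs.subspace_scale) (auto simp: affine_ext_def)
    moreover have "x - fscale (x n) (unit_vec n + a) + fscale (x n) (a - b) =
        x - fscale (x n) (unit_vec n + b)"
      by (auto simp: fun_eq_iff fscale_apply algebra_simps)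
    ultimately show "x \<in> affine_ext n W b"
      by (simp only: affine_ext_def mem_Collect_eq)
  qed
qed

text \<open>The representative is unique exactly modulo \<open>Z\<close>; every question of
  well-definedness and every fibre count below comes from this.\<close>

lemma affine_ext_eq_iff:
  assumes "Z \<in> Bq n" "W \<in> Bq n" "a \<in> vecs n" "b \<in> vecs n"
  shows "affine_ext n Z a = affine_ext n W b \<longleftrightarrow> Z = W \<and> a - b \<in> Z"
proof -
  have "b - a \<in> Z \<longleftrightarrow> a - b \<in> Z"
    using assms fs.subspace_neg[of Z] by (metis Bq_iff minus_diff_eq)
  then show ?thesis
    using affine_ext_subset_iff[OF assms(1,2,3), of b] affine_ext_subset_iff[OF assms(2,1,4), of a]
    by auto
qed

lemma Int_vecs_in_Bq: "Y \<in> Bq m \<Longrightarrow> Y \<inter> vecs n \<in> Bq n"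
  by (auto simp: Bq_iff intro: fs.subspace_inter subspace_vecs)

text \<open>An element of \<open>Y\<close> outside \<open>vecs n\<close> has nonzero coordinate
  \<open>n\<close>. Scaled to coordinate 1 it becomes \<open>unit_vec n + a\<close>, and subtracting
  multiples of it moves any element of \<open>Y\<close> into
  \<open>Y \<inter> vecs n\<close>.\<close>

lemma Aff_cases:
  assumes "Y \<in> Aff n"
  obtains Z a where "Z \<in> Bq n" "a \<in> vecs n" "Y = affine_ext n Z a"
proof -
  have Y: "fs.subspace Y" "Y \<subseteq> vecs (Suc n)" "\<not> Y \<subseteq> vecs n"
    using assms by (auto simp: Aff_def Bq_iff)
  then obtain y where y: "y \<in> Y" "y \<notin> vecs n" by auto
  have yn: "y n \<noteq> 0"
  proof
    assume "y n = 0"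
    moreover have "\<forall>i\<ge>Suc n. y i = 0"
      using y Y by (auto simp: vecs_def)
    ultimately have "\<forall>i\<ge>n. y i = 0"
      by (metis Suc_leI le_neq_implies_less)
    then show False using y by (simp add: vecs_def)
  qed
  define a where "a = fscale (1 / y n) y - unit_vec n"
  define Z where "Z = Y \<inter> vecs n"
  have ea: "unit_vec n + a = fscale (1 / y n) y"
    by (simp add: a_def)
  have eaY: "unit_vec n + a \<in> Y"
    unfolding ea using Y y by (intro fs.subspace_scale)
  have a: "a \<in> vecs n"
    unfolding vecs_def
  proof (clarify)
    fix i assume "n \<le> i"
    then consider "i = n" | "i \<ge> Suc n" by linarith
    then show "a i = 0"
    proof cases
      case 1 then show ?thesis using yn by (simp add: a_def unit_vec_def fscale_apply)
    next
      case 2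
      then have "y i = 0" using y Y by (auto simp: vecs_def)
      then show ?thesis using 2 by (simp add: a_def unit_vec_def fscale_apply)
    qed
  qed
  have mem: "x \<in> Y \<longleftrightarrow> x \<in> affine_ext n Z a" if "x \<in> vecs (Suc n)" for x
  proof -
    have "x - fscale (x n) (unit_vec n + a) \<in> vecs n"
      unfolding vecs_def
    proof (clarify)
      fix i assume "n \<le> i"
      then consider "i = n" | "i \<ge> Suc n" by linarith
      then show "(x - fscale (x n) (unit_vec n + a)) i = 0"
      proof cases
        case 1 then show ?thesis using unit_vec_plus_nth[OF a] by (simp add: fscale_apply)
      next
        case 2
        then show ?thesis using that a by (auto simp: vecs_def unit_vec_def fscale_apply)
      qed
    qed
    moreover have "x - fscale (x n) (unit_vec n + a) \<in> Y \<longleftrightarrow> x \<in> Y"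
    proof
      assume "x - fscale (x n) (unit_vec n + a) \<in> Y"
      then have "x - fscale (x n) (unit_vec n + a) + fscale (x n) (unit_vec n + a) \<in> Y"
        by (intro fs.subspace_add[OF Y(1)] fs.subspace_scale[OF Y(1)] eaY)
      then show "x \<in> Y" by simp
    next
      assume "x \<in> Y"
      then show "x - fscale (x n) (unit_vec n + a) \<in> Y"
        using Y eaY by (intro fs.subspace_diff fs.subspace_scale)
    qed
    ultimately show ?thesis
      by (auto simp: affine_ext_def Z_def)
  qed
  have "Y = affine_ext n Z a"
    using mem Y affine_ext_vecs[of Z n a] a by (auto simp: Z_def)
  moreover have "Z \<in> Bq n"
    using assms by (auto simp: Z_def Aff_def intro: Int_vecs_in_Bq)
  ultimately show ?thesis
    using that a by blast
qed

text \<open>Elements correspond to pairs of a coefficient and a member of \<open>Z\<close>: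
  coordinate \<open>n\<close> recovers the coefficient, because it vanishes on
  \<open>Z\<close>.\<close>

lemma card_affine_ext:
  fixes a :: "'a::{field,finite} fvec"
  assumes "Z \<in> Bq n" "a \<in> vecs n"
  shows "card (affine_ext n Z a) = CARD('a) * card Z"
proof -
  have "bij_betw (\<lambda>(k, z). fscale k (unit_vec n + a) + z) (UNIV \<times> Z) (affine_ext n Z a)"
  proof (rule bij_betw_byWitness[where f' = "\<lambda>x. (x n, x - fscale (x n) (unit_vec n + a))"])
    have nth: "(fscale k (unit_vec n + a) + z) n = k" if "z \<in> Z" for k z
    proof -
      have "z n = 0" using that assms by (auto simp: vecs_def Bq_iff)
      then show ?thesis using unit_vec_plus_nth[OF assms(2)] by (simp add: fscale_apply)
    qed
    have "((fscale k (unit_vec n + a) + z) n, fscale k (unit_vec n + a) + z -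
        fscale ((fscale k (unit_vec n + a) + z) n) (unit_vec n + a)) = (k, z)" if "z \<in> Z" for k z
      unfolding nth[OF that] by simp
    then show "\<forall>p\<in>UNIV \<times> Z. (\<lambda>x. (x n, x - fscale (x n) (unit_vec n + a)))
        ((\<lambda>(k, z). fscale k (unit_vec n + a) + z) p) = p"
      by (simp only: split_paired_Ball_Sigma split) blast
    show "\<forall>x\<in>affine_ext n Z a. (\<lambda>(k, z). fscale k (unit_vec n + a) + z)
        (x n, x - fscale (x n) (unit_vec n + a)) = x"
      by auto
    show "(\<lambda>(k, z). fscale k (unit_vec n + a) + z) ` (UNIV \<times> Z) \<subseteq> affine_ext n Z a"
    proof (clarify)
      fix k z assume z: "z \<in> Z"
      show "fscale k (unit_vec n + a) + z \<in> affine_ext n Z a"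
        unfolding affine_ext_def mem_Collect_eq nth[OF z] using z by simp
    qed
    show "(\<lambda>x. (x n, x - fscale (x n) (unit_vec n + a))) ` affine_ext n Z a \<subseteq> UNIV \<times> Z"
      by (auto simp: affine_ext_def)
  qed
  then show ?thesis
    by (simp add: bij_betw_same_card[symmetric] card_cartesian_product)
qed

lemma hat_eq_affine_ext:
  assumes "Z \<in> Bq n"
  shows "hat n Z = affine_ext n Z 0"
proof -
  have span: "fs.span Z = Z" using assms by (simp add: Bq_iff)
  have "x - fscale k (unit_vec n) \<in> Z \<Longrightarrow> k = x n" for x k
  proof -
    assume "x - fscale k (unit_vec n) \<in> Z"
    then have "(x - fscale k (unit_vec n)) n = 0" using assms by (auto simp: Bq_iff vecs_def)
    then show "k = x n" by (simp add: unit_vec_def fscale_apply)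
  qed
  then show ?thesis
    by (auto simp: hat_def fs.span_insert span affine_ext_def)
qed

lemma Bq_mono: "m \<le> n \<Longrightarrow> Bq m \<subseteq> Bq n"
  by (meson Bq_iff vecs_mono subset_iff)

lemma Bq_Suc: "Bq (Suc n) = Bq n \<union> Aff n" and Bq_Int_Aff: "Bq n \<inter> Aff n = {}"
  using Bq_mono[of n "Suc n"] by (auto simp: Aff_def Bq_iff)

lemma affine_ext_in_Bq: "Z \<in> Bq n \<Longrightarrow> a \<in> vecs n \<Longrightarrow> affine_ext n Z a \<in> Bq (Suc n)"
  using affine_ext_in_Aff Bq_Suc by blast

lemma zero_mem_vecs [simp]: "0 \<in> vecs n"
  by (rule fs.subspace_0[OF subspace_vecs])

lemma vecs_add: "a \<in> vecs n \<Longrightarrow> b \<in> vecs n \<Longrightarrow> a + b \<in> vecs n"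
  by (rule fs.subspace_add[OF subspace_vecs])

lemma vecs_diff: "a \<in> vecs n \<Longrightarrow> b \<in> vecs n \<Longrightarrow> a - b \<in> vecs n"
  by (rule fs.subspace_diff[OF subspace_vecs])

lemma covers_affine_ext_iff:
  assumes "Z \<in> Bq n" "W \<in> Bq n" "a \<in> vecs n" "b \<in> vecs n"
  shows "covers (affine_ext n Z a) (affine_ext n W b) \<longleftrightarrow> covers Z W \<and> b - a \<in> Z"
  using covers_iff_card[OF affine_ext_in_Bq[OF assms(2,4)] affine_ext_in_Bq[OF assms(1,3)]]
    covers_iff_card[OF assms(2,1)] affine_ext_subset_iff[OF assms(2,1,4), of a] assms
  by (auto simp: card_affine_ext)

text \<open>A subspace of \<open>vecs n\<close> inside the extension already lies in
  \<open>Z\<close>, and being covered forces it to be as large as \<open>Z\<close>.\<close>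

lemma covers_affine_ext_base_iff:
  assumes "Z \<in> Bq n" "W \<in> Bq n" "a \<in> vecs n"
  shows "covers (affine_ext n Z a) W \<longleftrightarrow> W = Z"
proof -
  have "W \<subseteq> affine_ext n Z a \<longleftrightarrow> W \<subseteq> Z"
    using affine_ext_Int_vecs[OF assms(1), of a] assms by (auto simp: Bq_iff)
  moreover have "W \<subseteq> Z \<Longrightarrow> card Z = card W \<Longrightarrow> W = Z"
    using card_subset_eq[of Z W] Bq_finite[OF assms(1)] by auto
  ultimately show ?thesis
    using covers_iff_card[OF assms(2) affine_ext_in_Bq[OF assms(1,3)]] assms
    by (auto simp: card_affine_ext)
qed

text \<open>The vectors \<open>a\<close> in a coset \<open>b + U\<close> with the same \<open>affine_ext n W a\<close> form a coset of \<open>W\<close>.\<close>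

lemma sum_affine_ext_fibres:
  fixes g :: "'a::{field,finite} fvec set \<Rightarrow> complex"
  assumes W: "W \<in> Bq n" and U: "U \<in> Bq n" and sub: "W \<subseteq> U" and b: "b \<in> vecs n"
  shows "(\<Sum>z\<in>U. g (affine_ext n W (b + z))) =
    of_nat (card W) * (\<Sum>Y\<in>(\<lambda>z. affine_ext n W (b + z)) ` U. g Y)"
proof -
  have fin: "finite U" using U Bq_finite by blast
  have Uv: "\<And>z. z \<in> U \<Longrightarrow> b + z \<in> vecs n"
    using U b by (auto simp: Bq_iff intro: vecs_add)
  have "(\<Sum>z\<in>U. g (affine_ext n W (b + z))) =
      (\<Sum>Y\<in>(\<lambda>z. affine_ext n W (b + z)) ` U.
         \<Sum>z\<in>{z \<in> U. affine_ext n W (b + z) = Y}. g (affine_ext n W (b + z)))"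
    by (rule sum.image_gen[OF fin])
  also have "\<dots> = (\<Sum>Y\<in>(\<lambda>z. affine_ext n W (b + z)) ` U. of_nat (card W) * g Y)"
  proof (rule sum.cong[OF refl], clarify)
    fix z assume z: "z \<in> U"
    have "{y \<in> U. affine_ext n W (b + y) = affine_ext n W (b + z)} = (\<lambda>w. z + w) ` W"
    proof (intro equalityI subsetI)
      fix y assume "y \<in> {y \<in> U. affine_ext n W (b + y) = affine_ext n W (b + z)}"
      then have "y - z \<in> W"
        using affine_ext_eq_iff[OF W W Uv Uv, of y z] z by simp
      then show "y \<in> (\<lambda>w. z + w) ` W"
        by (intro image_eqI[where x = "y - z"]) auto
    next
      fix y assume "y \<in> (\<lambda>w. z + w) ` W"
      then obtain w where w: "w \<in> W" "y = z + w" by auto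
      have y: "y \<in> U"
        using w z sub U fs.subspace_add[of U z w] by (auto simp: Bq_iff)
      then show "y \<in> {y \<in> U. affine_ext n W (b + y) = affine_ext n W (b + z)}"
        using affine_ext_eq_iff[OF W W Uv Uv, of y z] z w by simp
    qed
    moreover have "card ((\<lambda>w. z + w) ` W) = card W"
      by (intro card_image inj_onI) simp
    ultimately have "card {y \<in> U. affine_ext n W (b + y) = affine_ext n W (b + z)} = card W"
      by simp
    moreover have "(\<Sum>y\<in>{y \<in> U. affine_ext n W (b + y) = affine_ext n W (b + z)}.
        g (affine_ext n W (b + y))) =
      (\<Sum>y\<in>{y \<in> U. affine_ext n W (b + y) = affine_ext n W (b + z)}. g (affine_ext n W (b + z)))"
      by (rule sum.cong) auto
    ultimately show "(\<Sum>y\<in>{y \<in> U. affine_ext n W (b + y) = affine_ext n W (b + z)}.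
        g (affine_ext n W (b + y))) = of_nat (card W) * g (affine_ext n W (b + z))"
      by simp
  qed
  finally show ?thesis
    by (simp add: sum_distrib_left)
qed

section \<open>The operator on subspaces of a given space\<close>

text \<open>The operator read coefficient by coefficient: the value at \<open>W\<close> is collected
  from its neighbours. If \<open>Z\<close> covers \<open>W\<close>, the weight q^(dim Z - 1) is
  q^(dim W), that is \<open>card W\<close>. The ambient space is arbitrary because the hyperplanes
  \<open>perp n u\<close> are needed as well as \<open>vecs n\<close>.\<close>

definition cover_op :: "'a::{field,finite} fvec set \<Rightarrow> ('a fvec set \<Rightarrow> complex) \<Rightarrow> 'a fvec set \<Rightarrow> complex" where
  "cover_op X f W = (if W \<in> subspaces_of X then
     (\<Sum>Z\<in>{Z \<in> subspaces_of X. covers W Z}. f Z) +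
     of_nat (card W) * (\<Sum>Z\<in>{Z \<in> subspaces_of X. covers Z W}. f Z) else 0)"

lemma Aop_eq_cover_op:
  fixes f :: "'a::{field,finite} fvec set \<Rightarrow> complex"
  shows "Aop n f = cover_op (vecs n) f"
proof
  fix W :: "'a fvec set"
  \<comment> \<open>The truncated exponent is exact wherever it counts, since a space that covers
    another has positive dimension.\<close>
  have weight: "of_nat CARD('a) ^ (fs.dim Z - 1) * (if W \<in> Bq n \<and> covers Z W then 1 else 0) =
      (if W \<in> Bq n \<and> covers Z W then of_nat (card W) else (0::complex))" if "Z \<in> Bq n" for Z
  proof (cases "W \<in> Bq n \<and> covers Z W")
    case True
    then have "fs.dim Z - 1 = fs.dim W" by (simp add: covers_def)
    moreover have "card W = CARD('a) ^ fs.dim W"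
      using True Bq_finite[of W n] by (auto simp: Bq_iff intro: card_eq_power_dim)
    ultimately show ?thesis using True by simp
  next
    case False
    then show ?thesis by (simp only: if_False mult_zero_right)
  qed
  have "Aop n f W = (\<Sum>Z\<in>Bq n. f Z * ((if W \<in> Bq n \<and> covers W Z then 1 else 0) +
      of_nat CARD('a) ^ (fs.dim Z - 1) * (if W \<in> Bq n \<and> covers Z W then 1 else 0)))"
    unfolding Aop_def lin_ext_apply
    by (rule sum.cong[OF refl]) (simp add: sum_basis_vec fscale_apply)
  also have "\<dots> = (\<Sum>Z\<in>Bq n. (if W \<in> Bq n \<and> covers W Z then f Z else 0) +
      (if W \<in> Bq n \<and> covers Z W then of_nat (card W) * f Z else 0))"
    by (rule sum.cong[OF refl]) (simp only: weight, auto simp: algebra_simps)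
  also have "\<dots> = cover_op (vecs n) f W"
    unfolding cover_op_def Bq_def[symmetric]
    by (simp add: sum.distrib sum.inter_filter[symmetric] sum_distrib_left)
  finally show "Aop n f W = cover_op (vecs n) f W" .
qed

lemma cover_op_zero: "W \<notin> subspaces_of X \<Longrightarrow> cover_op X f W = 0"
  by (simp add: cover_op_def)

section \<open>Additive characters\<close>

definition dot :: "nat \<Rightarrow> 'a::{field,finite} fvec \<Rightarrow> 'a fvec \<Rightarrow> 'a" where
  "dot n u v = (\<Sum>i<n. u i * v i)"

definition perp :: "nat \<Rightarrow> 'a::{field,finite} fvec \<Rightarrow> 'a fvec set" where
  "perp n u = {x \<in> vecs n. dot n u x = 0}"

lemma dot_add: "dot n u (v + w) = dot n u v + dot n u w"
  by (simp add: dot_def algebra_simps sum.distrib)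

lemma dot_scale: "dot n u (fscale c v) = c * dot n u v"
  by (simp add: dot_def fscale_apply sum_distrib_left algebra_simps)

lemma dot_diff: "dot n u (v - w) = dot n u v - dot n u w"
  by (simp add: dot_def algebra_simps sum_subtractf)

lemma dot_commute: "dot n u v = dot n v u"
  by (simp add: dot_def mult.commute)

lemma dot_zero [simp]: "dot n u 0 = 0" "dot n 0 u = 0"
  by (simp_all add: dot_def)

lemma perp_in_Bq: "perp n u \<in> Bq n"
  by (auto simp: perp_def Bq_iff fs.subspace_def dot_add dot_scale
      intro: vecs_add fs.subspace_scale[OF subspace_vecs])

lemma perp_zero: "perp n 0 = vecs n"
  by (auto simp: perp_def)

lemma perp_subset_vecs: "perp n u \<subseteq> vecs n"
  by (auto simp: perp_def)

text \<open>Nondegeneracy of the dot product, tested on the unit vectors.\<close>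

lemma vecs_subset_perp_iff: "u \<in> vecs n \<Longrightarrow> vecs n \<subseteq> perp n u \<longleftrightarrow> u = 0"
proof
  assume u: "u \<in> vecs n" and *: "vecs n \<subseteq> perp n u"
  have "u i = 0" for i
  proof (cases "i < n")
    case True
    then have "unit_vec i \<in> vecs n" by (auto simp: unit_vec_def vecs_def)
    then have "dot n u (unit_vec i) = 0" using * by (auto simp: perp_def)
    then show ?thesis using True by (simp add: dot_def unit_vec_def if_distrib cong: if_cong)
  next
    case False
    then show ?thesis using u by (simp add: vecs_def)
  qed
  then show "u = 0" by (simp add: fun_eq_iff)
qed (simp add: perp_zero)

lemma subspaces_of_iff_Bq:
  "X \<in> Bq n \<Longrightarrow> Z \<in> subspaces_of X \<longleftrightarrow> Z \<in> Bq n \<and> Z \<subseteq> X"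
  by (auto simp: subspaces_of_def Bq_iff)

lemma vecs_Suc_in_Aff: "vecs (Suc n) \<in> Aff n"
proof -
  have "unit_vec n \<in> vecs (Suc n)" "unit_vec n \<notin> vecs n"
    by (auto simp: unit_vec_def vecs_def)
  then show ?thesis
    by (auto simp: Aff_def Bq_iff subspace_vecs)
qed

text \<open>\<open>vecs (Suc n)\<close> is itself an affine extension of \<open>vecs n\<close>, so
  each dimension contributes one factor.\<close>

lemma card_vecs: "card (vecs n :: 'a::{field,finite} fvec set) = CARD('a) ^ n"
proof (induction n)
  case 0
  then show ?case by (simp add: vecs_0)
next
  case (Suc n)
  have "vecs (Suc n) \<in> (Aff n :: 'a fvec set set)"
    by (rule vecs_Suc_in_Aff)
  then obtain Z a where Z: "Z \<in> Bq n" "a \<in> vecs n" "vecs (Suc n) = affine_ext n Z (a :: 'a fvec)"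
    by (rule Aff_cases)
  have "Z = vecs n"
    using affine_ext_Int_vecs[OF Z(1), of a] vecs_mono[of n "Suc n"] Z(3) by auto
  then show ?case
    using Z Suc card_affine_ext[OF Z(1,2)] by simp
qed

text \<open>One nontrivial \<psi> is enough: composed with the forms \<open>dot n u\<close> it
  yields every character of \<open>vecs n\<close>, as \<open>Nchars_eq\<close> shows.\<close>

locale nontrivial_char =
  fixes \<psi> :: "'a::{field,finite} \<Rightarrow> complex"
  assumes char_add: "\<psi> (x + y) = \<psi> x * \<psi> y"
    and norm_char: "norm (\<psi> x) = 1"
    and char_nontrivial: "\<exists>x. \<psi> x \<noteq> 1"
begin

lemma char_nonzero: "\<psi> x \<noteq> 0"
  using norm_char[of x] by auto

lemma char_zero [simp]: "\<psi> 0 = 1"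
  using char_add[of 0 0] char_nonzero[of 0] by simp

lemma char_minus: "\<psi> (- x) = cnj (\<psi> x)"
proof -
  have "\<psi> x * \<psi> (- x) = 1" using char_add[of x "- x"] by simp
  moreover have "\<psi> x * cnj (\<psi> x) = 1"
    by (simp add: complex_norm_square[symmetric] norm_char)
  ultimately show ?thesis
    using char_nonzero by (metis mult_cancel_left)
qed

text \<open>If some \<open>z0\<close> in \<open>Z\<close> is not orthogonal to \<open>u\<close>, a
  multiple \<open>z1\<close> of it has phase \<open>\<psi> x \<noteq> 1\<close>. Translation by
  \<open>z1\<close> permutes \<open>Z\<close> and multiplies the sum by this phase, so the sum is
  zero.\<close>

lemma sum_char_subspace:
  assumes "Z \<in> Bq n"
  shows "(\<Sum>z\<in>Z. \<psi> (- dot n u z)) = (if Z \<subseteq> perp n u then of_nat (card Z) else 0)"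
proof (cases "Z \<subseteq> perp n u")
  case True
  then have "(\<Sum>z\<in>Z. \<psi> (- dot n u z)) = (\<Sum>z\<in>Z. 1)"
    by (intro sum.cong) (auto simp: perp_def)
  then show ?thesis using True by simp
next
  case False
  have Z: "fs.subspace Z" using assms by (simp add: Bq_iff)
  obtain z0 where z0: "z0 \<in> Z" "dot n u z0 \<noteq> 0"
    using False assms by (auto simp: perp_def Bq_iff)
  obtain x where x: "\<psi> x \<noteq> 1" using char_nontrivial by auto
  define z1 where "z1 = fscale (- x / dot n u z0) z0"
  have z1: "z1 \<in> Z" "\<psi> (- dot n u z1) = \<psi> x"
    using z0 by (simp_all add: z1_def fs.subspace_scale[OF Z] dot_scale del: fs.scale_minus_left)
  have bij: "bij_betw (\<lambda>z. z1 + z) Z Z"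
  proof (rule bij_betw_byWitness[where f' = "\<lambda>z. z - z1"])
    show "(\<lambda>z. z1 + z) ` Z \<subseteq> Z" using fs.subspace_add[OF Z] z1 by auto
    show "(\<lambda>z. z - z1) ` Z \<subseteq> Z" using fs.subspace_diff[OF Z] z1 by auto
  qed auto
  have "(\<Sum>z\<in>Z. \<psi> (- dot n u z)) = (\<Sum>z\<in>Z. \<psi> (- dot n u (z1 + z)))"
    by (rule sum.reindex_bij_betw[OF bij, symmetric])
  also have "\<dots> = \<psi> x * (\<Sum>z\<in>Z. \<psi> (- dot n u z))"
    unfolding sum_distrib_left z1(2)[symmetric] char_add[symmetric]
    by (rule sum.cong) (auto simp: dot_add)
  finally show ?thesis
    using False x by simp
qed

text \<open>The dual orthogonality relation, over the characters instead of the vectors; it is the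
  previous one because \<open>dot\<close> is symmetric.\<close>

lemma sum_char_vecs:
  assumes "a \<in> vecs n"
  shows "(\<Sum>u\<in>vecs n. \<psi> (- dot n u a)) = (if a = 0 then of_nat (CARD('a) ^ n) else 0)"
proof -
  have "vecs n \<in> Bq n" by (simp add: Bq_iff subspace_vecs)
  then show ?thesis
    using sum_char_subspace[OF \<open>vecs n \<in> Bq n\<close>, of a] vecs_subset_perp_iff[OF assms]
    by (simp add: dot_commute[of n _ a] card_vecs)
qed

section \<open>The lifts twisted by characters and their two operator identities\<close>

text \<open>This is \<open>L\<^sub>u\<close>. Choosing a representative makes it total, hence linear
  without side conditions; the support condition is only needed to evaluate it. The case
  \<open>u = 0\<close> is included on purpose, so that \<open>theta\<close> and
  \<open>lambda\<close> are treated together.\<close>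

definition chi_lift :: "nat \<Rightarrow> 'a fvec \<Rightarrow> ('a fvec set \<Rightarrow> complex) \<Rightarrow> 'a fvec set \<Rightarrow> complex" where
  "chi_lift n u c Y = (if Y \<in> Aff n
     then \<psi> (- dot n u (SOME a. a \<in> vecs n \<and> unit_vec n + a \<in> Y)) * c (Y \<inter> vecs n) else 0)"

lemma chi_lift_outside: "Y \<notin> Aff n \<Longrightarrow> chi_lift n u c Y = 0"
  by (simp add: chi_lift_def)

text \<open>The chosen representative differs from \<open>b\<close> by an element of
  \<open>Z\<close>. Either \<open>Z\<close> is orthogonal to \<open>u\<close> and the phases agree,
  or \<open>c Z = 0\<close> by the support condition.\<close>

lemma chi_lift_affine_ext:
  assumes c: "c \<in> free_space (subspaces_of (perp n u))" and Z: "Z \<in> Bq n" and b: "b \<in> vecs n"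
  shows "chi_lift n u c (affine_ext n Z b) = \<psi> (- dot n u b) * c Z"
proof -
  define a where "a = (SOME a. a \<in> vecs n \<and> unit_vec n + a \<in> affine_ext n Z b)"
  have "b \<in> vecs n \<and> unit_vec n + b \<in> affine_ext n Z b"
    using Z b by (simp add: unit_vec_plus_mem_affine_ext_self)
  then have "a \<in> vecs n \<and> unit_vec n + a \<in> affine_ext n Z b"
    using someI[of "\<lambda>a. a \<in> vecs n \<and> unit_vec n + a \<in> affine_ext n Z b"] unfolding a_def by blast
  then have a: "a - b \<in> Z"
    using unit_vec_plus_mem_affine_ext[of a n Z b] by blast
  have eq: "chi_lift n u c (affine_ext n Z b) = \<psi> (- dot n u a) * c Z"
    using affine_ext_in_Aff[OF Z b] affine_ext_Int_vecs[OF Z, of b] by (simp add: chi_lift_def a_def)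
  show ?thesis
  proof (cases "Z \<subseteq> perp n u")
    case True
    then have "dot n u (a - b) = 0" using a by (auto simp: perp_def)
    then show ?thesis unfolding eq by (simp add: dot_diff)
  next
    case False
    then have "c Z = 0"
      using c free_space_iff[OF finite_subspaces_of[OF perp_subset_vecs]] unfolding subspaces_of_def by blast
    then show ?thesis unfolding eq by simp
  qed
qed

lemma cover_op_free_space: "X \<subseteq> vecs n \<Longrightarrow> cover_op X f \<in> free_space (subspaces_of X)"
  by (simp add: free_space_iff cover_op_zero)

text \<open>At \<open>W\<close> inside \<open>vecs n\<close>, only the extensions of
  \<open>W\<close> contribute, and their phases sum over all of \<open>vecs n\<close>; this gives
  the term with q^n when \<open>u = 0\<close> and cancels otherwise. At an extension of
  \<open>Z\<close>, one factor q arises downwards from the fibres over each subspace covered by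
  \<open>Z\<close>, and upwards from \<open>card W = q * card Z\<close>.\<close>

lemma cover_op_chi_lift:
  assumes u: "u \<in> vecs n" and c: "c \<in> free_space (subspaces_of (perp n u))"
  shows "cover_op (vecs (Suc n)) (chi_lift n u c) =
    fscale (of_nat CARD('a)) (chi_lift n u (cover_op (perp n u) c)) +
    fscale (if u = 0 then of_nat CARD('a) ^ n else 0) c"
proof
  let ?f = "chi_lift n u c" and ?X = "perp n u" and ?q = "of_nat CARD('a) :: complex"
  have sub: "Z \<in> subspaces_of ?X \<longleftrightarrow> Z \<in> Bq n \<and> Z \<subseteq> ?X" for Z
    by (rule subspaces_of_iff_Bq[OF perp_in_Bq])
  have c0: "c Z = 0" if "\<not> (Z \<in> Bq n \<and> Z \<subseteq> ?X)" for Z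
    using c that sub by (simp add: free_space_iff[OF finite_subspaces_of[OF perp_subset_vecs]])
  have vecsB: "vecs n \<in> Bq n" by (simp add: Bq_iff subspace_vecs)
  fix W :: "'a fvec set"
  consider (base) "W \<in> Bq n" | (aff) "W \<in> Aff n" | (none) "W \<notin> Bq (Suc n)"
    using Bq_Suc by blast
  then show "cover_op (vecs (Suc n)) ?f W =
    (fscale ?q (chi_lift n u (cover_op ?X c)) + fscale (if u = 0 then ?q ^ n else 0) c) W"
  proof cases
    case none
    then show ?thesis
      using Bq_Suc[where 'a = 'a, of n] c0
      by (auto simp: cover_op_def Bq_def[symmetric] chi_lift_outside fscale_apply)
  next
    case base
    then have nAff: "W \<notin> Aff n" using Bq_Int_Aff by blast
    have down: "(\<Sum>Z\<in>{Z \<in> Bq (Suc n). covers W Z}. ?f Z) = 0"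
    proof (rule sum.neutral, clarify)
      fix Z assume "Z \<in> Bq (Suc n)" "covers W Z"
      then have "Z \<notin> Aff n" using base by (auto simp: covers_def Bq_iff Aff_def)
      then show "?f Z = 0" by (rule chi_lift_outside)
    qed
    \<comment> \<open>Written with \<open>0 + z\<close> to fit \<open>sum_affine_ext_fibres\<close>
      with base point 0.\<close>
    have "(\<Sum>Z\<in>{Z \<in> Bq (Suc n). covers Z W}. ?f Z) =
        (\<Sum>Y\<in>(\<lambda>z. affine_ext n W (0 + z)) ` vecs n. ?f Y)"
    proof (rule sum.mono_neutral_right)
      show "finite {Z \<in> Bq (Suc n). covers Z W}" by simp
      show "(\<lambda>z. affine_ext n W (0 + z)) ` vecs n \<subseteq> {Z \<in> Bq (Suc n). covers Z W}"
        using base by (auto simp: affine_ext_in_Bq covers_affine_ext_base_iff)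
      show "\<forall>Z\<in>{Z \<in> Bq (Suc n). covers Z W} - (\<lambda>z. affine_ext n W (0 + z)) ` vecs n. ?f Z = 0"
      proof
        fix Y assume Y: "Y \<in> {Z \<in> Bq (Suc n). covers Z W} - (\<lambda>z. affine_ext n W (0 + z)) ` vecs n"
        have "Y \<notin> Aff n"
        proof
          assume "Y \<in> Aff n"
          then obtain Z a where Z: "Z \<in> Bq n" "a \<in> vecs n" "Y = affine_ext n Z a"
            by (rule Aff_cases)
          then have "W = Z"
            using Y covers_affine_ext_base_iff[OF Z(1) base Z(2)] by simp
          then show False using Y Z by auto
        qed
        then show "?f Y = 0" by (rule chi_lift_outside)
      qed
    qed
    \<comment> \<open>The weight \<open>card W\<close> is the size of the fibres of
      \<open>z \<mapsto> affine_ext n W z\<close>, so the weighted sum over subspaces is a plain sum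
      over vectors.\<close>
    then have "of_nat (card W) * (\<Sum>Z\<in>{Z \<in> Bq (Suc n). covers Z W}. ?f Z) =
        (\<Sum>z\<in>vecs n. ?f (affine_ext n W (0 + z)))"
      using sum_affine_ext_fibres[OF base vecsB _ zero_mem_vecs, of ?f] base by (simp add: Bq_iff)
    also have "\<dots> = (\<Sum>z\<in>vecs n. \<psi> (- dot n u z) * c W)"
      by (rule sum.cong) (auto simp: chi_lift_affine_ext[OF c base])
    also have "\<dots> = (if u = 0 then ?q ^ n else 0) * c W"
      using sum_char_subspace[OF vecsB, of u] vecs_subset_perp_iff[OF u]
      by (simp add: sum_distrib_right[symmetric] card_vecs)
    finally have up: "of_nat (card W) * (\<Sum>Z\<in>{Z \<in> Bq (Suc n). covers Z W}. ?f Z) =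
      (if u = 0 then ?q ^ n else 0) * c W" .
    have "W \<in> Bq (Suc n)" using base Bq_Suc by blast
    then have "cover_op (vecs (Suc n)) ?f W = (if u = 0 then ?q ^ n else 0) * c W"
      unfolding cover_op_def Bq_def[symmetric] down up by simp
    then show ?thesis
      using nAff by (simp add: chi_lift_outside fscale_apply)
  next
    case aff
    then obtain Z b where Z: "Z \<in> Bq n" and b: "b \<in> vecs n" and W: "W = affine_ext n Z b"
      by (rule Aff_cases)
    let ?e = "\<psi> (- dot n u b)"
    let ?D = "{Z' \<in> Bq n. covers Z Z'}" and ?U = "{Z' \<in> Bq n. covers Z' Z}"
    let ?T = "\<lambda>Z'. (\<lambda>z. affine_ext n Z' (b + z)) ` Z"
    have bz: "b + z \<in> vecs n" if "z \<in> Z" for z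
      using that b Z by (auto simp: Bq_iff intro: vecs_add)
    \<comment> \<open>Running over \<open>z \<in> Z\<close> counts each member of
      \<open>?T Z'\<close> exactly \<open>card Z'\<close> times, while the phases sum to
      \<open>card Z = q * card Z'\<close> or to 0. The quotient is q or 0.\<close>
    have inner: "(\<Sum>Y\<in>?T Z'. ?f Y) = ?e * (if Z \<subseteq> ?X then ?q else 0) * c Z'" if "Z' \<in> ?D" for Z'
    proof -
      from that have Z': "Z' \<in> Bq n" "Z' \<subseteq> Z" "card Z = CARD('a) * card Z'"
        using covers_iff_card[of Z' n Z n] Z by auto
      have "of_nat (card Z') * (\<Sum>Y\<in>?T Z'. ?f Y) = (\<Sum>z\<in>Z. ?f (affine_ext n Z' (b + z)))"
        by (rule sum_affine_ext_fibres[OF Z'(1) Z Z'(2) b, symmetric])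
      also have "\<dots> = (\<Sum>z\<in>Z. \<psi> (- dot n u z) * (?e * c Z'))"
      proof (rule sum.cong[OF refl])
        fix z assume "z \<in> Z"
        moreover have "\<psi> (- dot n u (b + z)) = \<psi> (- dot n u z) * ?e"
          by (simp add: dot_add char_add[symmetric] algebra_simps)
        ultimately show "?f (affine_ext n Z' (b + z)) = \<psi> (- dot n u z) * (?e * c Z')"
          by (simp add: chi_lift_affine_ext[OF c Z'(1) bz])
      qed
      also have "\<dots> = (if Z \<subseteq> ?X then of_nat (card Z) else 0) * (?e * c Z')"
        by (simp add: sum_distrib_right[symmetric] sum_char_subspace[OF Z])
      also have "\<dots> = of_nat (card Z') * (?e * (if Z \<subseteq> ?X then ?q else 0) * c Z')"
        using Z' by simp
      finally show ?thesis
        using card_Bq_pos[OF Z'(1)] by simp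
    qed
    have "(\<Sum>Y\<in>{Y \<in> Bq (Suc n). covers W Y}. ?f Y) = (\<Sum>Y\<in>(\<Union>Z'\<in>?D. ?T Z'). ?f Y)"
    proof (rule sum.mono_neutral_right)
      show "finite {Y \<in> Bq (Suc n). covers W Y}" by simp
      show "(\<Union>Z'\<in>?D. ?T Z') \<subseteq> {Y \<in> Bq (Suc n). covers W Y}"
        using Z b bz by (auto simp: W affine_ext_in_Bq covers_affine_ext_iff)
      show "\<forall>Y\<in>{Y \<in> Bq (Suc n). covers W Y} - (\<Union>Z'\<in>?D. ?T Z'). ?f Y = 0"
      proof
        fix Y assume Y: "Y \<in> {Y \<in> Bq (Suc n). covers W Y} - (\<Union>Z'\<in>?D. ?T Z')"
        have "Y \<notin> Aff n"
        proof
          assume "Y \<in> Aff n"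
          then obtain Z' a where Z': "Z' \<in> Bq n" "a \<in> vecs n" "Y = affine_ext n Z' a"
            by (rule Aff_cases)
          then have *: "covers Z Z'" "a - b \<in> Z"
            using Y covers_affine_ext_iff[OF Z Z'(1) b Z'(2)] by (auto simp: W)
          then have "Y \<in> ?T Z'"
            using Z' by (intro image_eqI[where x = "a - b"]) auto
          then show False using Y Z' * by blast
        qed
        then show "?f Y = 0" by (rule chi_lift_outside)
      qed
    qed
    also have "\<dots> = (\<Sum>Z'\<in>?D. \<Sum>Y\<in>?T Z'. ?f Y)"
    proof (rule sum.UNION_disjoint)
      show "\<forall>Z'\<in>?D. \<forall>Z''\<in>?D. Z' \<noteq> Z'' \<longrightarrow> ?T Z' \<inter> ?T Z'' = {}"
        using bz by (auto simp: affine_ext_eq_iff)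
    qed (use Z Bq_finite in auto)
    also have "\<dots> = (\<Sum>Z'\<in>?D. ?e * (if Z \<subseteq> ?X then ?q else 0) * c Z')"
      by (rule sum.cong[OF refl inner])
    finally have down: "(\<Sum>Y\<in>{Y \<in> Bq (Suc n). covers W Y}. ?f Y) =
      ?e * (if Z \<subseteq> ?X then ?q else 0) * (\<Sum>Z'\<in>?D. c Z')"
      by (simp add: sum_distrib_left)
    \<comment> \<open>Anything above \<open>W\<close> contains \<open>unit_vec n + b\<close>, so it
      can be written with the same representative \<open>b\<close>; upwards there is one extension
      for each \<open>Z'\<close> and no fibre.\<close>
    have set: "{Y \<in> Bq (Suc n). covers Y W} = (\<lambda>Z'. affine_ext n Z' b) ` ?U"
    proof (intro equalityI subsetI)
      fix Y assume Y: "Y \<in> {Y \<in> Bq (Suc n). covers Y W}"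
      then have "Y \<in> Aff n" using aff by (auto simp: covers_def Aff_def)
      then obtain Z' a where Z': "Z' \<in> Bq n" "a \<in> vecs n" "Y = affine_ext n Z' a"
        by (rule Aff_cases)
      then have *: "covers Z' Z" "b - a \<in> Z'"
        using Y covers_affine_ext_iff[OF Z'(1) Z Z'(2) b] by (auto simp: W)
      then have "Y = affine_ext n Z' b"
        using Z' affine_ext_eq_iff[OF Z'(1) Z'(1) b Z'(2)] by simp
      then show "Y \<in> (\<lambda>Z'. affine_ext n Z' b) ` ?U" using Z' * by blast
    next
      fix Y assume "Y \<in> (\<lambda>Z'. affine_ext n Z' b) ` ?U"
      then obtain Z' where "Z' \<in> Bq n" "covers Z' Z" "Y = affine_ext n Z' b" by auto
      then show "Y \<in> {Y \<in> Bq (Suc n). covers Y W}"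
        using Z b fs.subspace_0[of Z'] by (simp add: W affine_ext_in_Bq covers_affine_ext_iff) (simp add: Bq_iff)
    qed
    have "inj_on (\<lambda>Z'. affine_ext n Z' b) ?U"
      using b by (auto intro!: inj_onI simp: affine_ext_eq_iff)
    then have up: "(\<Sum>Y\<in>{Y \<in> Bq (Suc n). covers Y W}. ?f Y) = ?e * (\<Sum>Z'\<in>?U. c Z')"
      unfolding set
      by (simp add: sum.reindex chi_lift_affine_ext[OF c _ b] sum_distrib_left)
    have cardW: "of_nat (card W) = ?q * of_nat (card Z)"
      unfolding W by (simp add: card_affine_ext[OF Z b])
    have WB: "W \<in> Bq (Suc n)" "W \<notin> Bq n" using aff Bq_Suc Bq_Int_Aff by blast+
    have lhs: "cover_op (vecs (Suc n)) ?f W =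
        ?q * ?e * ((if Z \<subseteq> ?X then (\<Sum>Z'\<in>?D. c Z') else 0) + of_nat (card Z) * (\<Sum>Z'\<in>?U. c Z'))"
      unfolding cover_op_def Bq_def[symmetric] down up cardW using WB by (simp add: algebra_simps)
    \<comment> \<open>If \<open>Z\<close> is not contained in the hyperplane, nothing above it is,
      and \<open>c\<close> vanishes there. The downward sum got the same case distinction from the
      phases.\<close>
    have upX: "(\<Sum>Z'\<in>?U. c Z') = (if Z \<subseteq> ?X then (\<Sum>Z'\<in>{Z' \<in> subspaces_of ?X. covers Z' Z}. c Z') else 0)"
    proof (cases "Z \<subseteq> ?X")
      case True
      have "(\<Sum>Z'\<in>?U. c Z') = (\<Sum>Z'\<in>{Z' \<in> subspaces_of ?X. covers Z' Z}. c Z')"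
        using c0 by (intro sum.mono_neutral_right) (simp, auto simp only: sub)
      then show ?thesis using True by simp
    next
      case False
      have "(\<Sum>Z'\<in>?U. c Z') = 0"
        using False c0 by (intro sum.neutral) (auto simp only: covers_def)
      then show ?thesis using False by simp
    qed
    have downX: "(\<Sum>Z'\<in>?D. c Z') = (\<Sum>Z'\<in>{Z' \<in> subspaces_of ?X. covers Z Z'}. c Z')"
      using c0 by (intro sum.mono_neutral_right) (simp, auto simp only: sub)
    have "cover_op (vecs (Suc n)) ?f W = ?q * ?e * cover_op ?X c Z"
      unfolding lhs upX downX using Z by (simp add: cover_op_def sub)
    moreover have "chi_lift n u (cover_op ?X c) W = ?e * cover_op ?X c Z"
      unfolding W by (rule chi_lift_affine_ext[OF cover_op_free_space Z b]) (rule perp_subset_vecs)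
    moreover have "c W = 0" using WB c0 by blast
    ultimately show ?thesis
      by (simp add: fscale_apply)
  qed
qed

text \<open>A subspace not contained in \<open>vecs n\<close> covers exactly one subspace of
  \<open>vecs n\<close>, its intersection with it, and is covered by none of them. That single new
  term is the untwisted lift.\<close>

lemma cover_op_base:
  assumes c: "c \<in> free_space (Bq n)"
  shows "cover_op (vecs (Suc n)) c = cover_op (vecs n) c + chi_lift n 0 c"
proof
  have c0: "c Z = 0" if "Z \<notin> Bq n" for Z
    using c that by (simp add: free_space_iff)
  have c': "c \<in> free_space (subspaces_of (perp n 0))"
    using c by (simp add: perp_zero Bq_def)
  fix W :: "'a fvec set"
  consider (base) "W \<in> Bq n" | (aff) "W \<in> Aff n" | (none) "W \<notin> Bq (Suc n)"
    using Bq_Suc by blast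
  then show "cover_op (vecs (Suc n)) c W = (cover_op (vecs n) c + chi_lift n 0 c) W"
  proof cases
    case none
    then show ?thesis
      using Bq_Suc[where 'a = 'a, of n]
      by (auto simp: cover_op_def Bq_def[symmetric] chi_lift_outside)
  next
    case base
    then have W: "W \<notin> Aff n" "W \<in> Bq (Suc n)" using Bq_Int_Aff Bq_Suc by blast+
    have "(\<Sum>Z\<in>{Z \<in> Bq (Suc n). covers W Z}. c Z) = (\<Sum>Z\<in>{Z \<in> Bq n. covers W Z}. c Z)"
      "(\<Sum>Z\<in>{Z \<in> Bq (Suc n). covers Z W}. c Z) = (\<Sum>Z\<in>{Z \<in> Bq n. covers Z W}. c Z)"
      using Bq_Suc[where 'a = 'a, of n] c0 by (auto intro!: sum.mono_neutral_right)
    then show ?thesis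
      using W base by (simp add: cover_op_def Bq_def[symmetric] chi_lift_outside)
  next
    case aff
    then obtain Z b where Z: "Z \<in> Bq n" and b: "b \<in> vecs n" and W: "W = affine_ext n Z b"
      by (rule Aff_cases)
    have WB: "W \<in> Bq (Suc n)" "W \<notin> Bq n" using aff Bq_Suc Bq_Int_Aff by blast+
    have "(\<Sum>Y\<in>{Y \<in> Bq (Suc n). covers W Y}. c Y) = (\<Sum>Y\<in>{Z}. c Y)"
    proof (rule sum.mono_neutral_right)
      show "{Z} \<subseteq> {Y \<in> Bq (Suc n). covers W Y}"
        using Z b Bq_Suc[where 'a = 'a, of n] by (auto simp: W covers_affine_ext_base_iff)
      show "\<forall>Y\<in>{Y \<in> Bq (Suc n). covers W Y} - {Z}. c Y = 0"
      proof
        fix Y assume "Y \<in> {Y \<in> Bq (Suc n). covers W Y} - {Z}"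
        then have "Y \<notin> Bq n" using covers_affine_ext_base_iff[OF Z _ b, of Y] by (auto simp: W)
        then show "c Y = 0" by (rule c0)
      qed
    qed simp
    moreover have "(\<Sum>Y\<in>{Y \<in> Bq (Suc n). covers Y W}. c Y) = 0"
    proof (rule sum.neutral, clarify)
      fix Y assume "covers Y W"
      then have "Y \<notin> Bq n" using aff by (auto simp: covers_def Bq_iff Aff_def)
      then show "c Y = 0" by (rule c0)
    qed
    moreover have "chi_lift n 0 c W = c Z"
      unfolding W by (simp add: chi_lift_affine_ext[OF c' Z b])
    ultimately show ?thesis
      using WB by (simp add: cover_op_def Bq_def[symmetric])
  qed
qed

end

section \<open>Transport along an isomorphism\<close>

text \<open>Linearity is asked of all functions, which \<open>mat_vec\<close> provides, bijectivity
  only on \<open>vecs m\<close>. For \<open>T = tau n X\<close> the map \<open>push\<close> is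
  \<open>mu n X\<close>.\<close>

locale vecs_iso =
  fixes m n :: nat and T :: "'a::{field,finite} fvec \<Rightarrow> 'a fvec" and X :: "'a fvec set"
  assumes T_add: "T (v + w) = T v + T w"
    and T_scale: "T (fscale c v) = fscale c (T v)"
    and T_bij: "bij_betw T (vecs m) X"
    and X_Bq: "X \<in> Bq n"
begin

definition push :: "('a fvec set \<Rightarrow> complex) \<Rightarrow> 'a fvec set \<Rightarrow> complex" where
  "push = lin_ext (Bq m) (\<lambda>Y. basis_vec (T ` Y))"

lemma T_zero: "T 0 = 0"
  using T_scale[of 0 0] by simp

lemma image_subspaces_of:
  assumes "Y \<in> Bq m"
  shows "T ` Y \<in> subspaces_of X"
proof -
  have Y: "fs.subspace Y" using assms by (simp add: Bq_iff)
  have "fs.subspace (T ` Y)"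
    unfolding fs.subspace_def
  proof (intro conjI ballI allI)
    show "0 \<in> T ` Y" using fs.subspace_0[OF Y] T_zero by force
    show "x + y \<in> T ` Y" if "x \<in> T ` Y" "y \<in> T ` Y" for x y
      using that fs.subspace_add[OF Y] by (force simp: T_add[symmetric])
    show "fscale c x \<in> T ` Y" if "x \<in> T ` Y" for c x
      using that fs.subspace_scale[OF Y] by (force simp: T_scale[symmetric])
  qed
  moreover have "T ` Y \<subseteq> X"
    using assms T_bij by (auto simp: Bq_iff bij_betw_def)
  ultimately show ?thesis by (simp add: subspaces_of_def)
qed

lemma T_inj: "inj_on T (vecs m)"
  using T_bij by (rule bij_betw_imp_inj_on)

lemma bij_image: "bij_betw ((`) T) (Bq m) (subspaces_of X)"
  unfolding bij_betw_def
proof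
  show "inj_on ((`) T) (Bq m)"
    using T_inj by (auto intro!: inj_onI simp: Bq_iff inj_on_image_eq_iff)
  show "(`) T ` Bq m = subspaces_of X"
  proof (intro equalityI subsetI)
    fix W assume W: "W \<in> subspaces_of X"
    then have sub: "fs.subspace W" "W \<subseteq> X" by (auto simp: subspaces_of_def)
    let ?Y = "{v \<in> vecs m. T v \<in> W}"
    have "T ` ?Y = W"
      using sub T_bij by (auto simp: bij_betw_def)
    moreover have "?Y \<in> Bq m"
      unfolding Bq_iff fs.subspace_def
      using fs.subspace_0[OF sub(1)] fs.subspace_add[OF sub(1)] fs.subspace_scale[OF sub(1)]
        fs.subspace_scale[OF subspace_vecs]
      by (auto simp: T_zero T_add T_scale vecs_add)
    ultimately show "W \<in> (`) T ` Bq m" by blast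
  qed (auto simp: image_subspaces_of)
qed

lemma image_in_Bq: "Y \<in> Bq m \<Longrightarrow> T ` Y \<in> Bq n"
  using image_subspaces_of subspaces_of_iff_Bq[OF X_Bq] by blast

lemma card_image_Bq: "Y \<in> Bq m \<Longrightarrow> card (T ` Y) = card Y"
  by (rule card_image) (auto simp: Bq_iff intro: inj_on_subset[OF T_inj])

lemma covers_image_iff:
  assumes "Y \<in> Bq m" "Z \<in> Bq m"
  shows "covers (T ` Y) (T ` Z) \<longleftrightarrow> covers Y Z"
proof -
  have "Z \<subseteq> vecs m" "Y \<subseteq> vecs m" using assms by (auto simp: Bq_iff)
  then have "T ` Z \<subseteq> T ` Y \<longleftrightarrow> Z \<subseteq> Y"
    using inj_on_image_mem_iff[OF T_inj, of _ Y] by blast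
  then show ?thesis
    using covers_iff_card[OF image_in_Bq[OF assms(2)] image_in_Bq[OF assms(1)]]
      covers_iff_card[OF assms(2,1)] assms by (simp add: card_image_Bq)
qed

lemma push_outside: "W \<notin> subspaces_of X \<Longrightarrow> push f W = 0"
  using image_subspaces_of by (auto simp: push_def lin_ext_apply basis_vec_def intro!: sum.neutral)

lemma push_image:
  assumes "Y \<in> Bq m"
  shows "push f (T ` Y) = f Y"
proof -
  have "push f (T ` Y) = (\<Sum>Z\<in>Bq m. if Z = Y then f Z else 0)"
    unfolding push_def lin_ext_apply
    using bij_betw_imp_inj_on[OF bij_image] assms
    by (intro sum.cong) (auto simp: basis_vec_def dest: inj_onD)
  then show ?thesis using assms by simp
qed

lemma finite_subspaces_X: "finite (subspaces_of X)"
  by (rule finite_subspaces_of[of X n]) (use X_Bq in \<open>simp add: Bq_iff\<close>)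

lemma push_free_space: "push f \<in> free_space (subspaces_of X)"
  by (simp add: free_space_iff finite_subspaces_X push_outside)

lemma push_surj:
  assumes "c \<in> free_space (subspaces_of X)"
  obtains f where "f \<in> free_space (Bq m)" "push f = c"
proof
  let ?f = "\<lambda>Y. if Y \<in> Bq m then c (T ` Y) else 0"
  show "?f \<in> free_space (Bq m)" by (simp add: free_space_iff)
  show "push ?f = c"
  proof
    fix W show "push ?f W = c W"
    proof (cases "W \<in> subspaces_of X")
      case True
      then obtain Y where "Y \<in> Bq m" "W = T ` Y"
        using bij_betw_imp_surj_on[OF bij_image] by blast
      then show ?thesis by (simp add: push_image)
    next
      case False
      then show ?thesis
        using assms by (simp add: push_outside free_space_iff finite_subspaces_X)
    qed
  qed
qed

lemma push_eq_0:
  assumes "f \<in> free_space (Bq m)" "push f = 0"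
  shows "f = 0"
proof
  fix Y show "f Y = 0 Y"
    using push_image[of Y f] assms by (cases "Y \<in> Bq m") (auto simp: free_space_iff)
qed

text \<open>\<open>cover_op\<close> depends only on inclusions and cardinalities, and taking images
  under \<open>T\<close> is a bijection of subspaces that preserves both.\<close>

lemma cover_op_push: "cover_op X (push f) = push (cover_op (vecs m) f)"
proof
  fix W
  show "cover_op X (push f) W = push (cover_op (vecs m) f) W"
  proof (cases "W \<in> subspaces_of X")
    case True
    then obtain Y where Y: "Y \<in> Bq m" "W = T ` Y"
      using bij_betw_imp_surj_on[OF bij_image] by blast
    have bij: "bij_betw ((`) T) {Z \<in> Bq m. P Z} {Z \<in> subspaces_of X. Q Z}"
      if "\<And>Z. Z \<in> Bq m \<Longrightarrow> Q (T ` Z) \<longleftrightarrow> P Z" for P Q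
    proof -
      have "{Z \<in> subspaces_of X. Q Z} = (`) T ` {Z \<in> Bq m. P Z}"
        unfolding bij_betw_imp_surj_on[OF bij_image, symmetric] using that by auto
      then show ?thesis
        using bij_betw_imp_inj_on[OF bij_image] by (auto simp: bij_betw_def inj_on_def)
    qed
    have "(\<Sum>Z\<in>{Z \<in> subspaces_of X. covers W Z}. push f Z) = (\<Sum>Z\<in>{Z \<in> Bq m. covers Y Z}. push f (T ` Z))"
      by (rule sum.reindex_bij_betw[symmetric], rule bij) (simp add: Y covers_image_iff)
    moreover have "(\<Sum>Z\<in>{Z \<in> subspaces_of X. covers Z W}. push f Z) = (\<Sum>Z\<in>{Z \<in> Bq m. covers Z Y}. push f (T ` Z))"
      by (rule sum.reindex_bij_betw[symmetric], rule bij) (simp add: Y covers_image_iff)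
    ultimately show ?thesis
      using Y True by (simp add: push_image cover_op_def Bq_def[symmetric] card_image_Bq)
  next
    case False
    then show ?thesis by (simp add: push_outside cover_op_zero)
  qed
qed

end

section \<open>Schubert normal form\<close>

lemma mat_vec_add: "mat_vec c M (v + w) = mat_vec c M v + mat_vec c M w"
  by (simp add: mat_vec_def fun_eq_iff algebra_simps sum.distrib)

lemma mat_vec_scale: "mat_vec c M (fscale k v) = fscale k (mat_vec c M v)"
  by (simp add: mat_vec_def fun_eq_iff fscale_apply sum_distrib_left algebra_simps)

lemma mat_vec_unit_vec: "j < m \<Longrightarrow> mat_vec m M (unit_vec j) = (\<lambda>i. M i j)"
  by (auto simp: mat_vec_def unit_vec_def fun_eq_iff if_distrib cong: if_cong)

lemma image_mat_vec: "mat_vec m M ` vecs m = column_space m M"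
proof
  show "mat_vec m M ` vecs m \<subseteq> column_space m M"
  proof (clarify)
    fix v
    have "mat_vec m M v = (\<Sum>j<m. fscale (v j) (\<lambda>i. M i j))"
      by (auto simp: mat_vec_def fun_eq_iff sum_fun_apply fscale_apply mult.commute intro!: sum.cong)
    also have "\<dots> \<in> column_space m M"
      unfolding column_space_def by (intro fs.span_sum fs.span_scale fs.span_base) auto
    finally show "mat_vec m M v \<in> column_space m M" .
  qed
  have "fs.subspace (mat_vec m M ` vecs m)"
    unfolding fs.subspace_def
  proof (intro conjI ballI allI)
    have "mat_vec m M 0 = 0" by (simp add: mat_vec_def fun_eq_iff)
    then show "0 \<in> mat_vec m M ` vecs m" by (metis imageI zero_mem_vecs)
    show "x + y \<in> mat_vec m M ` vecs m" if "x \<in> mat_vec m M ` vecs m" "y \<in> mat_vec m M ` vecs m" for x y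
      using that vecs_add by (force simp: mat_vec_add[symmetric])
    show "fscale c x \<in> mat_vec m M ` vecs m" if "x \<in> mat_vec m M ` vecs m" for c x
      using that fs.subspace_scale[OF subspace_vecs] by (force simp: mat_vec_scale[symmetric])
  qed
  moreover have "(\<lambda>i. M i j) \<in> mat_vec m M ` vecs m" if "j < m" for j
    using mat_vec_unit_vec[OF that, of M] that
    by (intro image_eqI[where x = "unit_vec j"]) (auto simp: unit_vec_def vecs_def)
  ultimately show "column_space m M \<subseteq> mat_vec m M ` vecs m"
    unfolding column_space_def by (intro fs.span_minimal) auto
qed

text \<open>A pivot row is a unit row, so it reads a coefficient off a combination of the
  columns.\<close>

lemma schubert_coordinate:
  assumes "\<And>j'. j' < m \<Longrightarrow> M i j' = (if j = j' then 1 else 0)" "j < m"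
  shows "mat_vec m M v i = v j"
proof -
  have "mat_vec m M v i = (\<Sum>j'<m. if j' = j then v j' else 0)"
    unfolding mat_vec_def using assms by (intro sum.cong) auto
  then show ?thesis using assms by simp
qed

text \<open>The pivot rows are the positions of the last nonzero entries of vectors in the column space.\<close>

lemma schubert_pivots_subset:
  assumes M: "\<And>j i. j < m \<Longrightarrow> r j < i \<Longrightarrow> i < n \<Longrightarrow> M i j = 0"
      "\<And>j j'. j < m \<Longrightarrow> j' < m \<Longrightarrow> M (r j) j' = (if j = j' then 1 else 0)"
      "\<And>j. j < m \<Longrightarrow> r j < n"
    and M': "\<And>j i. j < m \<Longrightarrow> r' j < i \<Longrightarrow> i < n \<Longrightarrow> M' i j = 0"
      "\<And>j. j < m \<Longrightarrow> M' (r' j) j = 1" "\<And>j. j < m \<Longrightarrow> r' j < n"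
    and eq: "column_space m M = column_space m M'"
  shows "r' ` {..<m} \<subseteq> r ` {..<m}"
proof (clarify)
  fix j assume j: "j < m"
  have "(\<lambda>i. M' i j) \<in> column_space m M"
    unfolding eq unfolding column_space_def using j by (intro fs.span_base) auto
  then obtain v where v: "(\<lambda>i. M' i j) = mat_vec m M v"
    by (auto simp: image_mat_vec[symmetric])
  have vj: "v k = M' (r k) j" if "k < m" for k
    using schubert_coordinate[of m M "r k" k v] M(2) that fun_cong[OF v, of "r k"] by simp
  \<comment> \<open>Some column \<open>k\<close> contributes to the pivot entry. If
    \<open>r k\<close> were smaller than \<open>r' j\<close>, the entry of \<open>M\<close> would
    lie below its pivot; if it were larger, \<open>v k\<close> would be an entry of
    \<open>M'\<close> below its pivot. Both would be zero.\<close>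
  have "(\<Sum>k<m. M (r' j) k * v k) = 1"
    using fun_cong[OF v, of "r' j"] M'(2)[OF j] by (simp add: mat_vec_def)
  then obtain k where k: "k < m" "M (r' j) k * v k \<noteq> 0"
    by (metis (no_types, lifting) lessThan_iff sum.neutral zero_neq_one)
  have "\<not> r k < r' j" using M(1)[of k "r' j"] k M'(3)[OF j] by auto
  moreover have "\<not> r' j < r k" using M'(1)[of j "r k"] j k vj M(3)[of k] by auto
  ultimately have "r' j = r k" by simp
  then show "r' j \<in> r ` {..<m}" using k by auto
qed

text \<open>A finite set has only one increasing enumeration.\<close>

lemma strict_mono_on_image_unique:
  fixes r r' :: "nat \<Rightarrow> nat"
  assumes "strict_mono_on {..<m} r" "strict_mono_on {..<m} r'" "r ` {..<m} = r' ` {..<m}" "j < m"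
  shows "r j = r' j"
proof -
  have sorted: "sorted_wrt (<) (map s [0..<m])" if "strict_mono_on {..<m} s" for s :: "nat \<Rightarrow> nat"
    using that by (auto simp: sorted_wrt_iff_nth_less strict_mono_on_def)
  have "map r [0..<m] = map r' [0..<m]"
    using sorted[OF assms(1)] sorted[OF assms(2)] assms(3)
    by (intro sorted_distinct_set_unique)
       (auto simp: strict_sorted_iff atLeast0LessThan)
  then have "map r [0..<m] ! j = map r' [0..<m] ! j" by (rule arg_cong)
  then show ?thesis using assms(4) by simp
qed

text \<open>Equal column spaces have equal pivots. Column \<open>j\<close> of \<open>M'\<close> is
  then a combination of columns of \<open>M\<close> whose coefficients, read in the common pivot
  rows, are those of \<open>unit_vec j\<close>.\<close>

lemma schubert_nf_unique:
  fixes M M' :: "'a::{field,finite} fmat"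
  assumes M: "schubert_nf n m M" and M': "schubert_nf n m M'"
    and eq: "column_space m M = column_space m M'"
  shows "M = M'"
proof -
  obtain r where r: "strict_mono_on {..<m} r" "\<And>j. j < m \<Longrightarrow> r j < n"
      "\<And>j i. j < m \<Longrightarrow> r j < i \<Longrightarrow> i < n \<Longrightarrow> M i j = 0"
      "\<And>j j'. j < m \<Longrightarrow> j' < m \<Longrightarrow> M (r j) j' = (if j = j' then 1 else 0)"
    using M unfolding schubert_nf_def by blast
  obtain r' where r': "strict_mono_on {..<m} r'" "\<And>j. j < m \<Longrightarrow> r' j < n"
      "\<And>j i. j < m \<Longrightarrow> r' j < i \<Longrightarrow> i < n \<Longrightarrow> M' i j = 0"
      "\<And>j j'. j < m \<Longrightarrow> j' < m \<Longrightarrow> M' (r' j) j' = (if j = j' then 1 else 0)"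
    using M' unfolding schubert_nf_def by blast
  have "r' ` {..<m} \<subseteq> r ` {..<m}"
    by (rule schubert_pivots_subset[of m r n M r' M']) (use r r' eq in auto)
  moreover have "r ` {..<m} \<subseteq> r' ` {..<m}"
    by (rule schubert_pivots_subset[of m r' n M' r M]) (use r r' eq in auto)
  ultimately have rr': "r j = r' j" if "j < m" for j
    using strict_mono_on_image_unique[OF r(1) r'(1) _ that] by blast
  have "M i j = M' i j" for i j
  proof (cases "j < m")
    case True
    have "(\<lambda>i. M' i j) \<in> column_space m M"
      unfolding eq unfolding column_space_def using True by (intro fs.span_base) auto
    then obtain v where v: "(\<lambda>i. M' i j) = mat_vec m M v"
      by (auto simp: image_mat_vec[symmetric])
    have "v k = unit_vec j k" if k: "k < m" for k
    proof -
      have "mat_vec m M v (r k) = v k"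
        by (rule schubert_coordinate) (use r(4) k in auto)
      then show ?thesis
        using fun_cong[OF v, of "r k"] r'(4)[OF k True] rr'[OF k] by (simp add: unit_vec_def)
    qed
    then have "mat_vec m M v = mat_vec m M (unit_vec j)"
      by (simp add: mat_vec_def)
    then show ?thesis
      using v mat_vec_unit_vec[OF True, of M] by metis
  next
    case False
    then show ?thesis using M M' by (simp add: schubert_nf_def mats_def)
  qed
  then show ?thesis by blast
qed

lemma schubert_nf_inj:
  fixes M :: "'a::{field,finite} fmat"
  assumes "schubert_nf n m M"
  shows "inj_on (mat_vec m M) (vecs m)"
proof (rule inj_onI)
  fix v w :: "'a fvec"
  assume vw: "v \<in> vecs m" "w \<in> vecs m" "mat_vec m M v = mat_vec m M w"
  obtain r where r: "\<And>j j'. j < m \<Longrightarrow> j' < m \<Longrightarrow> M (r j) j' = (if j = j' then 1 else 0)"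
    using assms unfolding schubert_nf_def by blast
  show "v = w"
  proof
    fix j show "v j = w j"
    proof (cases "j < m")
      case True
      have "mat_vec m M x (r j) = x j" for x
        by (rule schubert_coordinate) (use r True in auto)
      then show ?thesis using vw(3) by metis
    next
      case False
      then show ?thesis using vw(1,2) by (simp add: vecs_def)
    qed
  qed
qed

text \<open>The first nonzero coordinate of \<open>u\<close> is the only row without a pivot.\<close>

lemma schubert_nf_perp_exists:
  fixes u :: "'a::{field,finite} fvec"
  assumes u: "u \<in> vecs n" "u \<noteq> 0"
  shows "\<exists>M. schubert_nf n (n - 1) M \<and> column_space (n - 1) M = perp n u"
proof -
  define i0 where "i0 = (LEAST i. u i \<noteq> 0)"
  have "\<exists>i. u i \<noteq> 0" using u by (auto simp: fun_eq_iff)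
  then have ui0: "u i0 \<noteq> 0" unfolding i0_def by (rule LeastI_ex)
  have less: "u i = 0" if "i < i0" for i
    using not_less_Least[of i "\<lambda>i. u i \<noteq> 0"] that by (auto simp: i0_def)
  have i0n: "i0 < n"
    using u(1) ui0 unfolding vecs_def mem_Collect_eq by (metis not_le)
  define r where "r j = (if j < i0 then j else Suc j)" for j
  \<comment> \<open>Column \<open>j\<close> is the unit vector at \<open>r j\<close>, corrected in
    row \<open>i0\<close> to be orthogonal to \<open>u\<close>. If \<open>i0\<close> lies below the
    pivot \<open>r j\<close>, then \<open>u (r j) = 0\<close> since \<open>i0\<close> is the first
    nonzero coordinate, so the correction never spoils the normal form.\<close>
  define M where "M i j = (if j < n - 1 then
    (if i = r j then 1 else if i = i0 then - u (r j) / u i0 else 0) else 0)" for i j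
  have r_ne: "r j \<noteq> i0" for j by (auto simp: r_def)
  have r_eq: "r j = r j' \<longleftrightarrow> j = j'" for j j' by (auto simp: r_def)
  have r_less: "r j < n" if "j < n - 1" for j using that by (auto simp: r_def)
  have rows: "M (r j) j' = (if j = j' then 1 else 0)" if "j' < n - 1" for j j'
    using that by (simp add: M_def r_eq r_ne)
  have "schubert_nf n (n - 1) M"
    unfolding schubert_nf_def
  proof (intro conjI exI[where x = r] allI impI)
    show "M \<in> mats n (n - 1)"
      using r_less i0n by (auto simp: mats_def M_def)
    show "strict_mono_on {..<n - 1} r" by (auto simp: strict_mono_on_def r_def)
    fix j assume j: "j < n - 1"
    show "r j < n" using r_less j .
    show "M (r j) j = 1" using j by (simp add: M_def)
    show "M i j = 0" if "r j < i \<and> i < n" for i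
      using that less[of "r j"] j by (auto simp: M_def)
    show "M (r j) j' = (if j = j' then 1 else 0)" if "j' < n - 1" for j'
      using rows that .
  qed
  moreover have "column_space (n - 1) M = perp n u"
  proof
    have perp: "fs.subspace (perp n u)" using perp_in_Bq by (auto simp: Bq_iff)
    have "(\<lambda>i. M i j) \<in> perp n u" if j: "j < n - 1" for j
    proof -
      have "dot n u (\<lambda>i. M i j) =
          (\<Sum>i<n. (if i = r j then u i else 0) + (if i = i0 then u i * (- u (r j) / u i0) else 0))"
        unfolding dot_def using j r_ne by (intro sum.cong) (auto simp: M_def)
      also have "\<dots> = 0"
        using r_less[OF j] i0n ui0 by (simp add: sum.distrib)
      finally show ?thesis
        using r_less[OF j] i0n by (auto simp: perp_def vecs_def M_def)
    qed
    then show sub: "column_space (n - 1) M \<subseteq> perp n u"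
      unfolding column_space_def by (intro fs.span_minimal perp) auto
    show "perp n u \<subseteq> column_space (n - 1) M"
    proof
      fix x assume x: "x \<in> perp n u"
      define v where "v j = (if j < n - 1 then x (r j) else 0)" for j
      \<comment> \<open>The coefficients \<open>v\<close> make \<open>w\<close> vanish off row
        \<open>i0\<close>; orthogonality to \<open>u\<close> then kills the remaining
        coordinate.\<close>
      define w where "w = x - mat_vec (n - 1) M v"
      have v: "v \<in> vecs (n - 1)" by (simp add: vecs_def v_def)
      then have Mv: "mat_vec (n - 1) M v \<in> column_space (n - 1) M"
        by (auto simp: image_mat_vec[symmetric])
      then have w: "w \<in> perp n u"
        unfolding w_def using x sub by (intro fs.subspace_diff[OF perp]) auto
      have w0: "w i = 0" if "i \<noteq> i0" for i
      proof (cases "i < n")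
        case True
        define j where "j = (if i < i0 then i else i - 1)"
        have j: "j < n - 1" "i = r j" using True that i0n by (auto simp: j_def r_def)
        have "mat_vec (n - 1) M v i = v j"
          unfolding j(2) by (rule schubert_coordinate) (use rows j in auto)
        then show ?thesis using j by (simp add: w_def v_def)
      next
        case False
        then show ?thesis using w by (simp add: perp_def vecs_def)
      qed
      have "(\<Sum>i<n. u i * w i) = (\<Sum>i<n. if i = i0 then u i * w i else 0)"
        by (rule sum.cong) (auto simp: w0)
      moreover have "(\<Sum>i<n. u i * w i) = 0" using w by (simp add: perp_def dot_def)
      ultimately have "w i0 = 0" using i0n ui0 by simp
      then have "w = 0" using w0 by (metis ext zero_fun_apply)
      then show "x \<in> column_space (n - 1) M" using Mv by (simp add: w_def)
    qed
  qed
  ultimately show ?thesis by blast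
qed

lemma Mmat_perp:
  assumes "u \<in> vecs n" "u \<noteq> 0"
  shows "schubert_nf n (n - 1) (Mmat n (perp n u))"
    and "column_space (n - 1) (Mmat n (perp n u)) = perp n u"
proof -
  have "\<exists>!M. schubert_nf n (n - 1) M \<and> column_space (n - 1) M = perp n u"
    using schubert_nf_perp_exists[OF assms] schubert_nf_unique by metis
  then have "schubert_nf n (n - 1) (Mmat n (perp n u)) \<and> column_space (n - 1) (Mmat n (perp n u)) = perp n u"
    unfolding Mmat_def by (rule theI')
  then show "schubert_nf n (n - 1) (Mmat n (perp n u))"
    "column_space (n - 1) (Mmat n (perp n u)) = perp n u" by auto
qed

lemma vecs_iso_tau:
  assumes "u \<in> vecs n" "u \<noteq> 0"
  shows "vecs_iso (n - 1) n (tau n (perp n u)) (perp n u)"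
proof
  show "bij_betw (tau n (perp n u)) (vecs (n - 1)) (perp n u)"
    using Mmat_perp[OF assms] schubert_nf_inj image_mat_vec unfolding tau_def bij_betw_def by metis
qed (simp_all add: tau_def mat_vec_add mat_vec_scale perp_in_Bq)

lemma dim_perp:
  fixes u :: "'a::{field,finite} fvec"
  assumes "u \<in> vecs n" "u \<noteq> 0"
  shows "fs.dim (perp n u) = n - 1"
proof -
  interpret vecs_iso "n - 1" n "tau n (perp n u)" "perp n u" by (rule vecs_iso_tau[OF assms])
  have "card (perp n u) = CARD('a) ^ (n - 1)"
    using bij_betw_same_card[OF T_bij] by (simp add: card_vecs)
  moreover have "card (perp n u) = CARD('a) ^ fs.dim (perp n u)"
    using X_Bq Bq_finite[OF X_Bq] by (intro card_eq_power_dim) (auto simp: Bq_iff)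
  ultimately show ?thesis
    using power_inject_exp[of "CARD('a)"] CARD_ge_2[where 'a = 'a] by simp
qed

section \<open>The unipotent group and its characters\<close>

lemma Hmat_nth: "i < n \<Longrightarrow> Hmat n a i n = a i"
  by (simp add: Hmat_def)

lemma Hmat_inj: "inj_on (Hmat n) (vecs n)"
proof (rule inj_onI)
  fix a b :: "'a fvec" assume ab: "a \<in> vecs n" "b \<in> vecs n" "Hmat n a = Hmat n b"
  show "a = b"
  proof
    fix i show "a i = b i"
    proof (cases "i < n")
      case True
      then show ?thesis using ab(3) Hmat_nth[of i n a] Hmat_nth[of i n b] by simp
    next
      case False
      then show ?thesis using ab by (simp add: vecs_def)
    qed
  qed
qed

text \<open>Identifies \<open>Hgrp n\<close> with the additive group \<open>vecs n\<close>.\<close>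

lemma mat_mul_Hmat: "mat_mul (Suc n) (Hmat n a) (Hmat n b) = Hmat n (a + b)"
proof (intro ext)
  fix i j
  have "mat_mul (Suc n) (Hmat n a) (Hmat n b) i j =
    (\<Sum>k<Suc n. (if k = i then (if i \<le> n then Hmat n b i j else 0) else 0) +
       (if k = n then (if i < n then a i * Hmat n b n j else 0) else 0))"
    unfolding mat_mul_def by (rule sum.cong) (auto simp: Hmat_def)
  also have "\<dots> = (if i \<le> n then Hmat n b i j else 0) + (if i < n then a i * Hmat n b n j else 0)"
    by (simp add: sum.distrib)
  also have "\<dots> = Hmat n (a + b) i j"
    by (auto simp: Hmat_def)
  finally show "mat_mul (Suc n) (Hmat n a) (Hmat n b) i j = Hmat n (a + b) i j" .
qed

lemma mat_vec_Hmat: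
  assumes "x \<in> vecs (Suc n)" "a \<in> vecs n"
  shows "mat_vec (n + 1) (Hmat n a) x = x + fscale (x n) a"
proof
  fix i
  have "mat_vec (n + 1) (Hmat n a) x i =
    (\<Sum>k<n + 1. (if k = i then (if i \<le> n then x i else 0) else 0) +
       (if k = n then (if i < n then a i * x n else 0) else 0))"
    unfolding mat_vec_def by (rule sum.cong) (auto simp: Hmat_def)
  also have "\<dots> = (if i \<le> n then x i else 0) + (if i < n then a i * x n else 0)"
    by (simp add: sum.distrib)
  also have "\<dots> = (x + fscale (x n) a) i"
    using assms by (auto simp: fscale_apply vecs_def)
  finally show "mat_vec (n + 1) (Hmat n a) x i = (x + fscale (x n) a) i" .
qed

text \<open>The group only translates the representative and leaves \<open>Z\<close> alone, because
  a unipotent matrix fixes \<open>vecs n\<close> pointwise.\<close>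

lemma mat_vec_Hmat_affine_ext:
  assumes "Z \<in> Bq n" "a \<in> vecs n" "b \<in> vecs n"
  shows "mat_vec (n + 1) (Hmat n a) ` affine_ext n Z b = affine_ext n Z (a + b)"
proof -
  have an: "a n = 0" using assms by (simp add: vecs_def)
  have "mat_vec (n + 1) (Hmat n a) ` affine_ext n Z b = (\<lambda>x. x + fscale (x n) a) ` affine_ext n Z b"
  proof (rule image_cong[OF refl])
    fix x assume "x \<in> affine_ext n Z b"
    then have "x \<in> vecs (Suc n)"
      using affine_ext_vecs[of Z n b] assms by (auto simp: Bq_iff)
    then show "mat_vec (n + 1) (Hmat n a) x = x + fscale (x n) a"
      using assms by (intro mat_vec_Hmat)
  qed
  also have "\<dots> = affine_ext n Z (a + b)"
  proof (intro equalityI subsetI)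
    fix y assume "y \<in> (\<lambda>x. x + fscale (x n) a) ` affine_ext n Z b"
    then obtain x where x: "x \<in> affine_ext n Z b" "y = x + fscale (x n) a" by auto
    have "y - fscale (y n) (unit_vec n + (a + b)) = x - fscale (x n) (unit_vec n + b)"
      using an by (auto simp: x(2) fun_eq_iff fscale_apply algebra_simps)
    then show "y \<in> affine_ext n Z (a + b)"
      using x(1) by (simp only: affine_ext_def mem_Collect_eq)
  next
    fix y assume y: "y \<in> affine_ext n Z (a + b)"
    let ?x = "y - fscale (y n) a"
    have xn: "?x n = y n" using an by (simp add: fscale_apply)
    have "?x - fscale (?x n) (unit_vec n + b) = y - fscale (y n) (unit_vec n + (a + b))"
      unfolding xn by (auto simp: fun_eq_iff fscale_apply algebra_simps)
    then have "?x \<in> affine_ext n Z b"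
      using y by (simp only: affine_ext_def mem_Collect_eq)
    moreover have "y = ?x + fscale (?x n) a" unfolding xn by simp
    ultimately show "y \<in> (\<lambda>x. x + fscale (x n) a) ` affine_ext n Z b" by blast
  qed
  finally show ?thesis .
qed

text \<open>The translation argument again, for a function not yet known to come from
  \<psi>.\<close>

lemma finite_multiplicative_sum_zero:
  fixes g :: "'a::{field,finite} fvec \<Rightarrow> complex"
  assumes mult: "\<And>a b. a \<in> vecs n \<Longrightarrow> b \<in> vecs n \<Longrightarrow> g (a + b) = g a * g b"
    and c: "c \<in> vecs n" "g c \<noteq> 1"
  shows "(\<Sum>a\<in>vecs n. g a) = 0"
proof -
  have "bij_betw (\<lambda>z. c + z) (vecs n) (vecs n)"
  proof (rule bij_betw_byWitness[where f' = "\<lambda>z. z - c"])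
    show "(\<lambda>z. c + z) ` vecs n \<subseteq> vecs n" using c vecs_add by auto
    show "(\<lambda>z. z - c) ` vecs n \<subseteq> vecs n" using c vecs_diff by auto
  qed auto
  then have "(\<Sum>a\<in>vecs n. g a) = (\<Sum>a\<in>vecs n. g (c + a))"
    by (rule sum.reindex_bij_betw[symmetric])
  also have "\<dots> = g c * (\<Sum>a\<in>vecs n. g a)"
    using c mult by (simp add: sum_distrib_left)
  finally show ?thesis using c by simp
qed

lemma carrier_Hgrp: "carrier (Hgrp n) = Hmat n ` vecs n"
  by (simp add: Hgrp_def)

lemma Nchars_iff:
  "\<chi> \<in> Nchars n \<longleftrightarrow> (\<forall>a\<in>vecs n. \<chi> (Hmat n a) \<noteq> 0) \<and>
     (\<forall>a\<in>vecs n. \<forall>b\<in>vecs n. \<chi> (Hmat n (a + b)) = \<chi> (Hmat n a) * \<chi> (Hmat n b)) \<and>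
     \<chi> \<in> extensional (carrier (Hgrp n)) \<and> (\<exists>a\<in>vecs n. \<chi> (Hmat n a) \<noteq> 1)"
  by (auto simp: Nchars_def hom_def Cstar_def Hgrp_def mat_mul_Hmat)

context nontrivial_char
begin

text \<open>The vector \<open>a\<close> is read off as the last column of the matrix. The
  restriction matches the extensionality demanded by \<open>Nchars\<close>.\<close>

definition chi :: "nat \<Rightarrow> 'a fvec \<Rightarrow> 'a fmat \<Rightarrow> complex" where
  "chi n u = restrict (\<lambda>g. \<psi> (dot n u (\<lambda>i. g i n))) (carrier (Hgrp n))"

lemma chi_Hmat: "a \<in> vecs n \<Longrightarrow> chi n u (Hmat n a) = \<psi> (dot n u a)"
  by (simp add: chi_def carrier_Hgrp dot_def Hmat_nth)

lemma char_dot_eq_1_iff: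
  assumes "u \<in> vecs n"
  shows "(\<forall>a\<in>vecs n. \<psi> (dot n u a) = 1) \<longleftrightarrow> u = 0"
proof
  assume *: "\<forall>a\<in>vecs n. \<psi> (dot n u a) = 1"
  have "vecs n \<in> Bq n" by (simp add: Bq_iff subspace_vecs)
  from sum_char_subspace[OF this, of u] have "vecs n \<subseteq> perp n u"
    using * by (auto simp: char_minus card_vecs split: if_splits)
  then show "u = 0" using vecs_subset_perp_iff[OF assms] by simp
qed simp

text \<open>That no character is missed follows from orthogonality rather than counting: if
  \<open>?f\<close> differed from all \<open>\<psi> (dot n u a)\<close>, each sum of
  \<open>?f a * \<psi> (- dot n u a)\<close> over \<open>a\<close> would vanish. Adding these over
  \<open>u\<close> leaves q^n times \<open>?f 0\<close>, which is not zero.\<close>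

lemma Nchars_eq: "Nchars n = chi n ` (vecs n - {0})"
proof (intro equalityI subsetI)
  fix \<chi> assume "\<chi> \<in> chi n ` (vecs n - {0})"
  then obtain u where u: "u \<in> vecs n" "u \<noteq> 0" "\<chi> = chi n u" by auto
  show "\<chi> \<in> Nchars n"
    unfolding Nchars_iff
  proof (intro conjI ballI)
    show "\<exists>a\<in>vecs n. \<chi> (Hmat n a) \<noteq> 1"
      using char_dot_eq_1_iff[OF u(1)] u by (simp add: chi_Hmat cong: bex_cong)
    show "\<chi> \<in> extensional (carrier (Hgrp n))" by (simp add: u chi_def)
  qed (simp_all add: u chi_Hmat char_nonzero vecs_add dot_add char_add)
next
  fix \<chi> :: "'a fmat \<Rightarrow> complex" assume \<chi>: "\<chi> \<in> Nchars n"
  let ?f = "\<lambda>a. \<chi> (Hmat n a)"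
  have f: "\<And>a. a \<in> vecs n \<Longrightarrow> ?f a \<noteq> 0"
      "\<And>a b. a \<in> vecs n \<Longrightarrow> b \<in> vecs n \<Longrightarrow> ?f (a + b) = ?f a * ?f b"
    using \<chi> by (auto simp: Nchars_iff)
  have f0: "?f 0 = 1" using f(1)[of 0] f(2)[of 0 0] by simp
  have "\<exists>u\<in>vecs n. \<forall>a\<in>vecs n. ?f a * \<psi> (- dot n u a) = 1"
  proof (rule ccontr)
    assume neg: "\<not> ?thesis"
    have zero: "(\<Sum>a\<in>vecs n. ?f a * \<psi> (- dot n u a)) = 0" if u: "u \<in> vecs n" for u
    proof -
      obtain c where "c \<in> vecs n" "?f c * \<psi> (- dot n u c) \<noteq> 1"
        using neg u by blast
      moreover have "\<psi> (- dot n u (a + b)) = \<psi> (- dot n u a) * \<psi> (- dot n u b)" for a b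
        by (simp add: dot_add char_add[symmetric])
      ultimately show ?thesis
        by (intro finite_multiplicative_sum_zero[where c = c]) (simp_all add: f(2))
    qed
    have "0 = (\<Sum>u\<in>vecs n. \<Sum>a\<in>vecs n. ?f a * \<psi> (- dot n u a))"
      using zero by simp
    also have "\<dots> = (\<Sum>a\<in>vecs n. \<Sum>u\<in>vecs n. ?f a * \<psi> (- dot n u a))"
      by (rule sum.swap)
    also have "\<dots> = (\<Sum>a\<in>(vecs n :: 'a fvec set). if a = 0 then of_nat (CARD('a) ^ n) else 0)"
      by (rule sum.cong[OF refl]) (simp add: sum_distrib_left[symmetric] sum_char_vecs f0)
    finally show False by simp
  qed
  then obtain u where u: "u \<in> vecs n" "\<And>a. a \<in> vecs n \<Longrightarrow> ?f a * \<psi> (- dot n u a) = 1"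
    by blast
  have eq: "?f a = \<psi> (dot n u a)" if "a \<in> vecs n" for a
  proof -
    have "\<psi> (dot n u a) * \<psi> (- dot n u a) = 1" by (simp add: char_add[symmetric])
    then show ?thesis using u(2)[OF that] char_nonzero by (metis mult_right_cancel)
  qed
  have "\<chi> = chi n u"
  proof (rule extensionalityI)
    show "\<chi> \<in> extensional (carrier (Hgrp n))" using \<chi> by (simp add: Nchars_iff)
    show "chi n u \<in> extensional (carrier (Hgrp n))" by (simp add: chi_def)
    show "\<chi> g = chi n u g" if "g \<in> carrier (Hgrp n)" for g
      using that by (auto simp: carrier_Hgrp eq chi_Hmat)
  qed
  moreover have "u \<noteq> 0"
  proof
    assume "u = 0"
    then have "\<forall>a\<in>vecs n. ?f a = 1" by (simp add: eq)
    then show False using \<chi> by (auto simp: Nchars_iff)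
  qed
  ultimately show "\<chi> \<in> chi n ` (vecs n - {0})" using u by blast
qed

lemma chi_inj: "inj_on (chi n) (vecs n)"
proof (rule inj_onI)
  fix u w assume uw: "u \<in> vecs n" "w \<in> vecs n" "chi n u = chi n w"
  have "\<psi> (dot n (u - w) a) = 1" if a: "a \<in> vecs n" for a
  proof -
    have "\<psi> (dot n u a) = \<psi> (dot n w a)" using uw(3) chi_Hmat[OF a] by metis
    moreover have "dot n (u - w) a = dot n u a + - dot n w a"
      using dot_diff[of n a u w] by (simp add: dot_commute[of n _ a])
    ultimately have "\<psi> (dot n (u - w) a) = \<psi> (dot n w a + - dot n w a)"
      by (simp only: char_add)
    then show ?thesis by simp
  qed
  then have "u - w = 0" using char_dot_eq_1_iff[OF vecs_diff[OF uw(1,2)]] by blast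
  then show "u = w" by simp
qed

section \<open>The isotypic components\<close>

lemma theta_eq_chi_lift: "theta n f = chi_lift n 0 f"
proof
  fix Y :: "'a fvec set"
  have "theta n f Y = (\<Sum>Z\<in>Bq n. if Z = Y \<inter> vecs n then (if Y \<in> Aff n then f Z else 0) else 0)"
    unfolding theta_def lin_ext_apply by (rule sum.cong[OF refl]) (auto simp: sum_basis_vec)
  also have "\<dots> = chi_lift n 0 f Y"
    by (auto simp: chi_lift_def Aff_def Int_vecs_in_Bq)
  finally show "theta n f Y = chi_lift n 0 f Y" .
qed

lemma chi_lift_add: "chi_lift n u (f + g) = chi_lift n u f + chi_lift n u g"
  by (simp add: fun_eq_iff chi_lift_def algebra_simps)

lemma chi_lift_scale: "chi_lift n u (fscale c f) = fscale c (chi_lift n u f)"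
  by (simp add: fun_eq_iff chi_lift_def fscale_apply)

lemma chi_lift_zero: "chi_lift n u 0 = 0"
  by (simp add: fun_eq_iff chi_lift_def)

lemma chi_lift_sum: "chi_lift n u (\<Sum>i\<in>I. f i) = (\<Sum>i\<in>I. chi_lift n u (f i))"
  by (simp add: fun_eq_iff chi_lift_def sum_fun_apply sum_distrib_left)

text \<open>The projection p(chi) of the hat of \<open>Z\<close>, written as a sum over translates
  without matrices. It is used for \<open>u = 0\<close> as well, which Fourier inversion
  requires.\<close>

definition char_sum :: "nat \<Rightarrow> 'a fvec \<Rightarrow> 'a fvec set \<Rightarrow> 'a fvec set \<Rightarrow> complex" where
  "char_sum n u Z = (\<Sum>a\<in>vecs n. fscale (\<psi> (- dot n u a)) (basis_vec (affine_ext n Z a)))"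

text \<open>The coefficient at an extension of \<open>Z\<close> collects the phases over a coset of
  \<open>Z\<close>, so it is \<open>card Z\<close> times one phase or cancels. This explains both
  the factor q^(-dim Y) in \<open>lambda\<close> and the choice of the hyperplane
  \<open>Xchi\<close>.\<close>

lemma char_sum_eq:
  assumes Z: "Z \<in> Bq n"
  shows "char_sum n u Z =
    (if Z \<subseteq> perp n u then fscale (of_nat (card Z)) (chi_lift n u (basis_vec Z)) else 0)"
proof
  fix Y :: "'a fvec set"
  show "char_sum n u Z Y =
    (if Z \<subseteq> perp n u then fscale (of_nat (card Z)) (chi_lift n u (basis_vec Z)) else 0) Y"
  proof (cases "Y \<in> Aff n")
    case False
    then have "char_sum n u Z Y = 0"
      using affine_ext_in_Aff[OF Z]
      by (auto simp: char_sum_def sum_fun_apply fscale_apply basis_vec_def intro!: sum.neutral)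
    then show ?thesis using False by (simp add: fscale_apply chi_lift_outside)
  next
    case True
    then obtain W b where W: "W \<in> Bq n" and b: "b \<in> vecs n" and Y: "Y = affine_ext n W b"
      by (rule Aff_cases)
    have rhs: "chi_lift n u (basis_vec Z) Y = \<psi> (- dot n u b) * basis_vec Z W" if "Z \<subseteq> perp n u"
      unfolding Y using Z that
      by (intro chi_lift_affine_ext W b basis_vec_free_space) (simp add: subspaces_of_iff_Bq[OF perp_in_Bq])
    have lhs: "char_sum n u Z Y = (\<Sum>a\<in>vecs n. if W = Z \<and> a - b \<in> Z then \<psi> (- dot n u a) else 0)"
      unfolding char_sum_def sum_fun_apply Y
    proof (rule sum.cong[OF refl])
      fix a :: "'a fvec" assume a: "a \<in> vecs n"
      have "affine_ext n W b = affine_ext n Z a \<longleftrightarrow> W = Z \<and> a - b \<in> Z"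
        using affine_ext_eq_iff[OF Z W a b] by auto
      then show "fscale (\<psi> (- dot n u a)) (basis_vec (affine_ext n Z a)) (affine_ext n W b) =
          (if W = Z \<and> a - b \<in> Z then \<psi> (- dot n u a) else 0)"
        by (simp add: fscale_apply basis_vec_def)
    qed
    show ?thesis
    proof (cases "W = Z")
      case False
      then have "basis_vec Z W = 0" by (simp add: basis_vec_def)
      then show ?thesis unfolding lhs using False by (simp add: fscale_apply rhs)
    next
      case [simp]: True
      have "char_sum n u Z Y = (\<Sum>a\<in>{a \<in> vecs n. a - b \<in> Z}. \<psi> (- dot n u a))"
        unfolding lhs by (simp add: sum.inter_filter)
      also have "\<dots> = (\<Sum>z\<in>Z. \<psi> (- dot n u (b + z)))"
      proof (rule sum.reindex_bij_betw[symmetric], rule bij_betw_byWitness[where f' = "\<lambda>a. a - b"])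
        show "(\<lambda>z. b + z) ` Z \<subseteq> {a \<in> vecs n. a - b \<in> Z}"
          using Z b by (auto simp: Bq_iff intro: vecs_add)
      qed auto
      also have "\<dots> = \<psi> (- dot n u b) * (\<Sum>z\<in>Z. \<psi> (- dot n u z))"
        by (simp add: dot_add char_add[symmetric] sum_distrib_left)
      finally have "char_sum n u Z Y = \<psi> (- dot n u b) * (\<Sum>z\<in>Z. \<psi> (- dot n u z))" .
      moreover have "basis_vec Z W = 1" by (simp add: basis_vec_def)
      ultimately show ?thesis
        by (simp add: sum_char_subspace[OF Z] fscale_apply rhs)
    qed
  qed
qed

lemma pchi_hat:
  assumes Z: "Z \<in> Bq n"
  shows "pchi n (chi n u) (basis_vec (hat n Z)) = char_sum n u Z"
proof -
  have hat: "hat n Z = affine_ext n Z 0" by (rule hat_eq_affine_ext[OF Z])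
  have "act n (Hmat n a) (basis_vec (hat n Z)) = basis_vec (affine_ext n Z a)" if "a \<in> vecs n" for a
    using affine_ext_in_Aff[OF Z, of 0] mat_vec_Hmat_affine_ext[OF Z that, of 0]
    by (simp add: act_def hat lin_ext_basis_vec)
  then show ?thesis
    unfolding pchi_def carrier_Hgrp char_sum_def
    by (simp add: sum.reindex[OF Hmat_inj] chi_Hmat char_minus)
qed

text \<open>By \<open>char_sum_eq\<close> the projection can be nonzero only for subspaces of
  \<open>perp n u\<close>; among these the prescribed dimension singles out the hyperplane
  itself.\<close>

lemma Xchi_chi:
  assumes u: "u \<in> vecs n" "u \<noteq> 0"
  shows "Xchi n (chi n u) = perp n u"
  unfolding Xchi_def
proof (rule the_equality)
  let ?X = "perp n u"
  have X: "?X \<in> Bq n" by (rule perp_in_Bq)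
  have "chi_lift n u (basis_vec ?X) (affine_ext n ?X 0) = \<psi> (- dot n u 0) * basis_vec ?X ?X"
    using X by (intro chi_lift_affine_ext basis_vec_free_space) (auto simp: subspaces_of_iff_Bq)
  then have "char_sum n u ?X (affine_ext n ?X 0) \<noteq> 0"
    using card_Bq_pos[OF X] by (simp add: char_sum_eq[OF X] fscale_apply basis_vec_def)
  then have "pchi n (chi n u) (basis_vec (hat n ?X)) \<noteq> 0"
    by (auto simp: pchi_hat[OF X])
  then show "?X \<in> Bq n \<and> fs.dim ?X = n - 1 \<and> pchi n (chi n u) (basis_vec (hat n ?X)) \<noteq> 0"
    using X dim_perp[OF u] by simp
next
  fix X assume *: "X \<in> Bq n \<and> fs.dim X = n - 1 \<and> pchi n (chi n u) (basis_vec (hat n X)) \<noteq> 0"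
  then have "char_sum n u X \<noteq> 0" using pchi_hat[of X n u] by auto
  then have sub: "X \<subseteq> perp n u" using * char_sum_eq[of X n u] by (auto split: if_splits)
  have "card X = card (perp n u)"
    using * dim_perp[OF u] card_eq_power_dim[of X] card_eq_power_dim[of "perp n u"]
      Bq_finite[of X n] Bq_finite[OF perp_in_Bq[of n u]] perp_in_Bq[of n u]
    by (simp add: Bq_iff)
  then show "X = perp n u"
    using card_subset_eq[OF Bq_finite[OF perp_in_Bq] sub] by simp
qed

lemma lambda_chi:
  assumes u: "u \<in> vecs n" "u \<noteq> 0" and c: "c \<in> free_space (subspaces_of (perp n u))"
  shows "lambda n (chi n u) c = chi_lift n u c"
proof -
  have fin: "finite (subspaces_of (perp n u))" by (rule finite_subspaces_of[OF perp_subset_vecs])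
  have "lambda n (chi n u) c = (\<Sum>Y\<in>subspaces_of (perp n u).
      fscale (c Y) (fscale (1 / of_nat CARD('a) ^ fs.dim Y) (char_sum n u Y)))"
    unfolding lambda_def lin_ext_def Xchi_chi[OF u]
    by (rule sum.cong[OF refl]) (simp add: pchi_hat subspaces_of_iff_Bq[OF perp_in_Bq])
  also have "\<dots> = (\<Sum>Y\<in>subspaces_of (perp n u). chi_lift n u (fscale (c Y) (basis_vec Y)))"
  proof (rule sum.cong[OF refl])
    fix Y assume "Y \<in> subspaces_of (perp n u)"
    then have Y: "Y \<in> Bq n" "Y \<subseteq> perp n u" by (auto simp: subspaces_of_iff_Bq[OF perp_in_Bq])
    have "card Y = CARD('a) ^ fs.dim Y"
      using Y Bq_finite[OF Y(1)] by (auto simp: Bq_iff intro: card_eq_power_dim)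
    then have "fscale (1 / of_nat CARD('a) ^ fs.dim Y) (char_sum n u Y) = chi_lift n u (basis_vec Y)"
      using Y by (simp add: char_sum_eq)
    then show "fscale (c Y) (fscale (1 / of_nat CARD('a) ^ fs.dim Y) (char_sum n u Y)) =
        chi_lift n u (fscale (c Y) (basis_vec Y))"
      by (simp only: chi_lift_scale)
  qed
  also have "\<dots> = chi_lift n u c"
    unfolding chi_lift_sum[symmetric] free_space_expansion[OF fin c, symmetric] ..
  finally show ?thesis .
qed

end

section \<open>Existence of a nontrivial additive character\<close>

text \<open>Modulo a maximal proper additive subgroup \<open>S\<close>, every element is an integer multiple of a
  fixed \<open>g \<notin> S\<close>, so that the quotient is cyclic and embeds into the unit circle.\<close>

lemma nontrivial_char_exists: "\<exists>\<psi> :: 'a::{field,finite} \<Rightarrow> complex. nontrivial_char \<psi>"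
proof -
  define subgrp where "subgrp S \<longleftrightarrow> 0 \<in> S \<and> (\<forall>x\<in>S. \<forall>y\<in>S. x - y \<in> S)" for S :: "'a set"
  have "(1 :: 'a) \<notin> {0}" by simp
  then have "{0} \<noteq> (UNIV :: 'a set)" by blast
  then have "{0} \<in> {S. subgrp S \<and> S \<noteq> UNIV}" by (simp add: subgrp_def)
  moreover have "finite {S. subgrp S \<and> S \<noteq> UNIV}" by simp
  ultimately obtain S where S: "subgrp S" "S \<noteq> UNIV"
      and max: "\<And>S'. subgrp S' \<Longrightarrow> S' \<noteq> UNIV \<Longrightarrow> S \<subseteq> S' \<Longrightarrow> S = S'"
    using finite_has_maximal[of "{S. subgrp S \<and> S \<noteq> UNIV}"] by blast
  have S0: "0 \<in> S" and Sdiff: "\<And>x y. x \<in> S \<Longrightarrow> y \<in> S \<Longrightarrow> x - y \<in> S"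
    using S(1) by (auto simp: subgrp_def)
  have Sneg: "- x \<in> S" if "x \<in> S" for x using Sdiff[OF S0 that] by simp
  have Sadd: "x + y \<in> S" if "x \<in> S" "y \<in> S" for x y using Sdiff[OF that(1) Sneg[OF that(2)]] by simp
  have Snat: "of_nat k * x \<in> S" if "x \<in> S" for k x
    using that by (induction k) (auto simp: S0 Sadd algebra_simps)
  have Sint: "of_int k * x \<in> S" if "x \<in> S" for k x
    using Snat[OF that] Sneg by (cases k rule: int_cases2) auto
  obtain g where g: "g \<notin> S" using S(2) by auto
  \<comment> \<open>\<open>S'\<close> is \<open>S\<close> with the integer multiples of
    \<open>g\<close> adjoined, so maximality makes it everything.\<close>
  define S' where "S' = {x. \<exists>k::int. x - of_int k * g \<in> S}"
  have "subgrp S'"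
    unfolding subgrp_def
  proof (intro conjI ballI)
    show "0 \<in> S'" using S0 by (auto simp: S'_def intro!: exI[where x = 0])
    fix x y assume "x \<in> S'" "y \<in> S'"
    then obtain k l where "x - of_int k * g \<in> S" "y - of_int l * g \<in> S" by (auto simp: S'_def)
    from Sdiff[OF this] have "x - y - of_int (k - l) * g \<in> S" by (simp add: algebra_simps)
    then show "x - y \<in> S'" unfolding S'_def by blast
  qed
  moreover have "S \<subseteq> S'" by (auto simp: S'_def intro!: exI[where x = 0])
  moreover have "g \<in> S'" using S0 by (auto simp: S'_def intro!: exI[where x = 1])
  ultimately have "S' = UNIV" using max g by blast
  then have ex: "\<exists>k::int. x - of_int k * g \<in> S" for x by (auto simp: S'_def)
  have "\<not> inj (of_nat :: nat \<Rightarrow> 'a)"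
    using finite_imageD[of "of_nat :: nat \<Rightarrow> 'a" UNIV] by auto
  then obtain i j where "i < j" "of_nat i = (of_nat j :: 'a)"
    by (metis injI linorder_neqE_nat)
  then have "0 < j - i \<and> of_nat (j - i) * g \<in> S" by (simp add: of_nat_diff S0)
  then have m_ex: "\<exists>m>0. of_nat m * g \<in> S" by blast
  \<comment> \<open>The order of \<open>g\<close> modulo \<open>S\<close>; it exists because a
    finite field has positive characteristic.\<close>
  define m where "m = (LEAST m. 0 < m \<and> of_nat m * g \<in> S)"
  have m: "0 < m" "of_nat m * g \<in> S"
    using LeastI_ex[OF m_ex] by (auto simp: m_def)
  have dvd: "int m dvd k" if k: "of_int k * g \<in> S" for k
  proof (rule ccontr)
    assume "\<not> int m dvd k"
    then have "k mod int m \<noteq> 0" by (simp only: dvd_eq_mod_eq_0 not_False_eq_True)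
    moreover have "0 \<le> k mod int m" using m(1) by (intro pos_mod_sign) simp
    ultimately have pos: "0 < nat (k mod int m)" by linarith
    have "of_int (k mod int m) * g = of_int k * g - of_int (k div int m) * (of_nat m * g)"
    proof -
      have "(of_int k :: 'a) = of_int (k div int m * int m + k mod int m)" by simp
      also have "\<dots> = of_int (k div int m) * of_nat m + of_int (k mod int m)"
        by (simp only: of_int_add of_int_mult of_int_of_nat_eq)
      finally have "of_int k * g = of_int (k div int m) * (of_nat m * g) + of_int (k mod int m) * g"
        by (simp only: distrib_right mult.assoc)
      then show ?thesis by simp
    qed
    then have "of_int (k mod int m) * g \<in> S" using Sdiff[OF k Sint[OF m(2)]] by simp
    then have "of_nat (nat (k mod int m)) * g \<in> S" using m(1) by simp
    then have "m \<le> nat (k mod int m)" unfolding m_def using pos by (intro Least_le) (simp add: m_def)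
    then show False using m(1) pos_mod_bound[of "int m" k] by linarith
  qed
  \<comment> \<open>The exponent \<open>k\<close> is determined only modulo \<open>m\<close>, which
    an \<open>m\<close>-th root of unity does not notice.\<close>
  define \<psi> where "\<psi> x = cis (2 * pi * (of_int (SOME k. x - of_int k * g \<in> S) / of_nat m))" for x
  have \<psi>: "\<psi> x = cis (2 * pi * (of_int k / of_nat m))" if k: "x - of_int k * g \<in> S" for x k
  proof -
    define l where "l = (SOME k. x - of_int k * g \<in> S)"
    have l: "x - of_int l * g \<in> S" unfolding l_def using k by (rule someI)
    have "of_int (l - k) * g \<in> S" using Sdiff[OF k l] by (simp add: algebra_simps)
    then have "int m dvd l - k" by (rule dvd)
    then obtain t where "l - k = int m * t" by (elim dvdE)
    then have "l = k + int m * t" by simp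
    then have "2 * pi * (of_int l / of_nat m) = 2 * pi * (of_int k / of_nat m) + 2 * pi * of_int t"
      using m(1) by (simp add: field_simps)
    then show ?thesis
      unfolding \<psi>_def l_def[symmetric] by (simp add: cis_mult[symmetric] cis_multiple_2pi)
  qed
  have "nontrivial_char \<psi>"
  proof
    fix x y
    obtain k l where kl: "x - of_int k * g \<in> S" "y - of_int l * g \<in> S" using ex by blast
    from Sadd[OF this] have "x + y - of_int (k + l) * g \<in> S" by (simp add: algebra_simps)
    then show "\<psi> (x + y) = \<psi> x * \<psi> y"
      using \<psi>[OF kl(1)] \<psi>[OF kl(2)] \<psi>[of "x + y" "k + l"]
      by (simp add: cis_mult add_divide_distrib distrib_left)
    show "norm (\<psi> x) = 1" by (simp add: \<psi>_def)
  next
    have "m \<noteq> 1" using m g by auto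
    have "\<psi> g = cis (2 * pi * (1 / of_nat m))" using \<psi>[of g 1] S0 by simp
    moreover have "cis (2 * pi * (1 / of_nat m)) \<noteq> 1"
    proof
      assume "cis (2 * pi * (1 / of_nat m)) = 1"
      then have "cos (2 * pi * (1 / of_nat m)) = 1" by (metis cis.sel(1) one_complex.sel(1))
      then obtain t :: int where "2 * pi * (1 / of_nat m) = of_int t * 2 * pi"
        unfolding cos_one_2pi_int by blast
      then have "1 = real_of_int (t * int m)" using m(1) by (simp add: field_simps)
      then have "t * int m = 1" by linarith
      then show False using \<open>m \<noteq> 1\<close> by (simp add: zmult_eq_1_iff)
    qed
    ultimately show "\<exists>x. \<psi> x \<noteq> 1" by metis
  qed
  then show ?thesis by blast
qed

section \<open>Decomposition of the space and induction\<close>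

lemma cover_op_add: "cover_op X (f + g) = cover_op X f + cover_op X g"
  by (simp add: fun_eq_iff cover_op_def sum.distrib algebra_simps)

lemma cover_op_scale: "cover_op X (fscale c f) = fscale c (cover_op X f)"
  by (simp add: fun_eq_iff cover_op_def fscale_apply sum_distrib_left algebra_simps)

lemma qnum_Suc: "qnum q (Suc m) = qnum q m + q ^ m"
  by (simp add: qnum_def)

lemma qnum_Suc_shift: "qnum q (Suc m) = 1 + q * qnum q m"
  unfolding qnum_def by (subst sum.lessThan_Suc_shift) (simp add: sum_distrib_left)

lemma Nnz_snoc: "Nnz (\<beta> @ [a]) = Nnz \<beta> + (if a = Ent0 then 0 else 1)"
  by (simp add: Nnz_def)

lemma mu_eq_push: "u \<in> vecs n \<Longrightarrow> u \<noteq> 0 \<Longrightarrow> mu n (perp n u) = vecs_iso.push (n - 1) (tau n (perp n u))"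
  by (rule ext) (simp only: mu_def vecs_iso.push_def[OF vecs_iso_tau] not_False_eq_True)

lemma mu_add: "mu n X (f + g) = mu n X f + mu n X g"
  by (simp add: mu_def lin_ext_add)

lemma mu_scale: "mu n X (fscale c f) = fscale c (mu n X f)"
  by (simp add: mu_def lin_ext_scale)

lemma mu_zero: "mu n X 0 = 0"
  by (simp add: mu_def lin_ext_apply fun_eq_iff)

lemma mu_sum: "mu n X (\<Sum>i\<in>I. f i) = (\<Sum>i\<in>I. mu n X (f i))"
  by (simp add: mu_def lin_ext_sum)

lemma Bq_0: "Bq 0 = {{0}}"
proof (intro equalityI subsetI)
  fix Z :: "'a fvec set" assume "Z \<in> Bq 0"
  then have "Z \<subseteq> {0}" "0 \<in> Z" using fs.subspace_0 by (auto simp: Bq_iff vecs_0)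
  then show "Z \<in> {{0}}" by auto
qed (auto simp: Bq_iff vecs_0)

lemma affine_ext_0: "Y \<in> Aff 0 \<Longrightarrow> Y = affine_ext 0 {0} 0"
  by (erule Aff_cases) (auto simp: Bq_0 vecs_0)

section \<open>Recursion for the index sequences and their vectors\<close>

context nontrivial_char
begin

text \<open>One recursion for all dimensions: at \<open>n = 0\<close> there is no nonzero
  \<open>u\<close>, so the truncated \<open>n - 1\<close> is never reached and \<open>Eq 1\<close>
  comes out right.\<close>

lemma Eq_Suc:
  "(Eq (Suc n) :: 'a entry list set) = (\<lambda>\<beta>. \<beta> @ [Ent0]) ` Eq n \<union> (\<lambda>\<beta>. \<beta> @ [Ent1]) ` Eq n \<union>
    (\<Union>u\<in>vecs n - {0}. (\<lambda>\<beta>. \<beta> @ [EntChi (chi n u)]) ` Eq (n - 1))"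
proof (cases n)
  case 0
  then show ?thesis by (auto simp: vecs_0)
next
  case (Suc m)
  have "(Eq (Suc (Suc m)) :: 'a entry list set) =
     {\<beta> @ [a] |\<beta> a. \<beta> \<in> Eq (Suc m) \<and> a \<in> {Ent0, Ent1}} \<union>
     {\<beta> @ [EntChi \<chi>] |\<beta> \<chi>. \<beta> \<in> Eq m \<and> \<chi> \<in> chi (Suc m) ` (vecs (Suc m) - {0})}"
    by (simp only: Eq.simps Nchars_eq)
  then show ?thesis
    unfolding Suc by (simp only: diff_Suc_1) blast
qed

lemma finite_Eq: "finite (Eq n :: 'a entry list set)"
proof (induction n rule: less_induct)
  case (less n)
  show ?case
  proof (cases n)
    case (Suc m)
    then show ?thesis using less[of m] less[of "m - 1"] by (simp add: Eq_Suc)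
  qed simp
qed

lemma sum_Eq_Suc:
  fixes F :: "'a entry list \<Rightarrow> 'b::comm_monoid_add"
  shows "(\<Sum>\<alpha>\<in>Eq (Suc n). F \<alpha>) =
    (\<Sum>\<beta>\<in>Eq n. F (\<beta> @ [Ent0])) + (\<Sum>\<beta>\<in>Eq n. F (\<beta> @ [Ent1])) +
    (\<Sum>u\<in>vecs n - {0}. \<Sum>\<beta>\<in>Eq (n - 1). F (\<beta> @ [EntChi (chi n u)]))"
proof -
  have inj: "inj_on (\<lambda>\<beta>. \<beta> @ [a]) B" for a :: "'a entry" and B by (auto intro: inj_onI)
  have "(\<Sum>\<alpha>\<in>(\<Union>u\<in>vecs n - {0}. (\<lambda>\<beta>. \<beta> @ [EntChi (chi n u)]) ` Eq (n - 1)). F \<alpha>) =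
      (\<Sum>u\<in>vecs n - {0}. \<Sum>\<alpha>\<in>(\<lambda>\<beta>. \<beta> @ [EntChi (chi n u)]) ` Eq (n - 1). F \<alpha>)"
    using inj_onD[OF chi_inj[of n]]
    by (intro sum.UNION_disjoint) (auto simp: finite_Eq)
  also have "\<dots> = (\<Sum>u\<in>vecs n - {0}. \<Sum>\<beta>\<in>Eq (n - 1). F (\<beta> @ [EntChi (chi n u)]))"
    by (simp add: sum.reindex[OF inj])
  moreover have "(\<Sum>\<alpha>\<in>Eq (Suc n). F \<alpha>) =
      (\<Sum>\<alpha>\<in>(\<lambda>\<beta>. \<beta> @ [Ent0]) ` Eq n \<union> (\<lambda>\<beta>. \<beta> @ [Ent1]) ` Eq n. F \<alpha>) +
      (\<Sum>\<alpha>\<in>(\<Union>u\<in>vecs n - {0}. (\<lambda>\<beta>. \<beta> @ [EntChi (chi n u)]) ` Eq (n - 1)). F \<alpha>)"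
    unfolding Eq_Suc by (rule sum.union_disjoint) (auto simp: finite_Eq)
  moreover have "(\<Sum>\<alpha>\<in>(\<lambda>\<beta>. \<beta> @ [Ent0]) ` Eq n \<union> (\<lambda>\<beta>. \<beta> @ [Ent1]) ` Eq n. F \<alpha>) =
      (\<Sum>\<alpha>\<in>(\<lambda>\<beta>. \<beta> @ [Ent0]) ` Eq n. F \<alpha>) + (\<Sum>\<alpha>\<in>(\<lambda>\<beta>. \<beta> @ [Ent1]) ` Eq n. F \<alpha>)"
    by (rule sum.union_disjoint) (auto simp: finite_Eq)
  ultimately show ?thesis by (simp add: sum.reindex[OF inj])
qed

text \<open>Makes the explicit vectors in dimension 1 instances of the general recursion, with both
  powers of q equal to 1.\<close>

lemma chi_lift_0: "chi_lift 0 0 (basis_vec {0}) = basis_vec (vecs 1)"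
proof
  fix Y :: "'a fvec set"
  have 1: "Y \<in> Aff 0 \<longleftrightarrow> Y = vecs 1"
    using affine_ext_0[of Y] affine_ext_0[of "vecs 1"] vecs_Suc_in_Aff[of 0] by auto
  have "Y \<in> Aff 0 \<Longrightarrow> Y \<inter> vecs 0 = {0}"
    using fs.subspace_0[of Y] by (auto simp: Aff_def Bq_iff vecs_0)
  then show "chi_lift 0 0 (basis_vec {0}) Y = basis_vec (vecs 1) Y"
    using 1 by (auto simp: chi_lift_def basis_vec_def)
qed

lemma vvec_Ent0:
  assumes "\<beta> \<in> Eq n"
  shows "vvec (Suc n) (\<beta> @ [Ent0]) =
    fscale (of_nat CARD('a) ^ Nnz \<beta>) (vvec n \<beta>) + chi_lift n 0 (vvec n \<beta>)"
proof (cases n)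
  case 0
  then show ?thesis using assms chi_lift_0 by (simp add: Nnz_def)
qed (simp add: Let_def theta_eq_chi_lift)

lemma vvec_Ent1:
  assumes "\<beta> \<in> Eq n"
  shows "vvec (Suc n) (\<beta> @ [Ent1]) =
    fscale (of_nat CARD('a) ^ (n - Nnz \<beta>)) (vvec n \<beta>) - chi_lift n 0 (vvec n \<beta>)"
proof (cases n)
  case 0
  then show ?thesis using assms chi_lift_0 by (simp add: Nnz_def)
qed (simp add: Let_def theta_eq_chi_lift)

lemma mu_free_space:
  assumes "u \<in> vecs n" "u \<noteq> 0"
  shows "mu n (perp n u) f \<in> free_space (subspaces_of (perp n u))"
  using vecs_iso.push_free_space[OF vecs_iso_tau[OF assms]] by (simp add: mu_eq_push[OF assms])

lemma vvec_EntChi: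
  assumes "u \<in> vecs n" "u \<noteq> 0"
  shows "vvec (Suc n) (\<beta> @ [EntChi (chi n u)]) = chi_lift n u (mu n (perp n u) (vvec (n - 1) \<beta>))"
proof (cases n)
  case 0
  then show ?thesis using assms by (simp add: vecs_0)
next
  case (Suc m)
  have "vvec (Suc (Suc m)) (\<beta> @ [EntChi (chi n u)]) = lambda n (chi n u) (mu n (Xchi n (chi n u)) (vvec m \<beta>))"
    by (simp add: Suc Let_def)
  then show ?thesis
    using mu_free_space[OF assms] by (simp add: Suc Xchi_chi[OF assms, unfolded Suc] lambda_chi[OF assms, unfolded Suc])
qed

lemma free_space_Bq_Suc:
  fixes f :: "'a fvec set \<Rightarrow> complex"
  shows "f \<in> free_space (Bq n) \<Longrightarrow> f \<in> free_space (Bq (Suc n))"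
  "chi_lift n u c \<in> free_space (Bq (Suc n))"
  using Bq_Suc[where 'a = 'a, of n] by (simp_all add: free_space_iff chi_lift_outside)

section \<open>Eigenvectors\<close>

text \<open>The bound on \<open>Nnz \<alpha>\<close> is part of the induction so that the natural
  number subtraction in the eigenvalue is genuine. Membership in the free space supplies the support
  condition of the lifts.\<close>

lemma vvec_eigenvector:
  "\<forall>\<alpha> \<in> (Eq n :: 'a entry list set). vvec n \<alpha> \<in> free_space (Bq n) \<and> Nnz \<alpha> \<le> n \<and>
    cover_op (vecs n) (vvec n \<alpha>) =
      fscale (qnum (of_nat CARD('a)) (n - Nnz \<alpha>) - qnum (of_nat CARD('a)) (Nnz \<alpha>)) (vvec n \<alpha>)"
  (is "?P n")
proof (induction n rule: less_induct)
  case (less n)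
  show ?case
  proof (cases n)
    case 0
    have sub: "subspaces_of (vecs 0) = {{0 :: 'a fvec}}" using Bq_0 by (simp add: Bq_def)
    have "\<not> covers {0} {0 :: 'a fvec}" by (simp add: covers_def)
    then have e: "{Z \<in> subspaces_of (vecs 0). covers {0 :: 'a fvec} Z} = {}"
        "{Z \<in> subspaces_of (vecs 0). covers Z {0 :: 'a fvec}} = {}"
      by (auto simp: sub)
    have "cover_op (vecs 0) (basis_vec {0 :: 'a fvec}) = 0"
    proof
      fix W :: "'a fvec set"
      show "cover_op (vecs 0) (basis_vec {0}) W = 0 W"
      proof (cases "W = {0}")
        case True
        show ?thesis unfolding True cover_op_def e by simp
      qed (simp add: cover_op_def sub)
    qed
    then show ?thesis
      unfolding 0 by (simp add: Nnz_def basis_vec_free_space Bq_0)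
  next
    case (Suc m)
    let ?q = "of_nat CARD('a) :: complex"
    note free = fs.subspace_add[OF subspace_free_space] fs.subspace_diff[OF subspace_free_space]
      fs.subspace_scale[OF subspace_free_space] free_space_Bq_Suc
    have IH: "?P m" using less Suc by simp
    have ent: "vvec (Suc m) \<alpha> \<in> free_space (Bq (Suc m)) \<and> Nnz \<alpha> \<le> Suc m \<and>
      cover_op (vecs (Suc m)) (vvec (Suc m) \<alpha>) =
        fscale (qnum ?q (Suc m - Nnz \<alpha>) - qnum ?q (Nnz \<alpha>)) (vvec (Suc m) \<alpha>)"
      if \<beta>: "\<beta> \<in> Eq m" and \<alpha>: "\<alpha> = \<beta> @ [Ent0] \<or> \<alpha> = \<beta> @ [Ent1]" for \<alpha> \<beta> :: "'a entry list"
    proof -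
      define k where "k = Nnz \<beta>"
      define v where "v = vvec m \<beta>"
      define l where "l = chi_lift m 0 v"
      have v: "v \<in> free_space (Bq m)" "k \<le> m"
          "cover_op (vecs m) v = fscale (qnum ?q (m - k) - qnum ?q k) v"
        using IH \<beta> by (auto simp: v_def k_def)
      then obtain j where j: "m = k + j" using le_Suc_ex by blast
      have c1: "cover_op (vecs (Suc m)) v = fscale (qnum ?q j - qnum ?q k) v + l"
        using cover_op_base[OF v(1)] v(3) j by (simp add: l_def)
      have "cover_op (vecs (Suc m)) l =
          fscale ?q (chi_lift m 0 (cover_op (vecs m) v)) + fscale (?q ^ m) v"
        using cover_op_chi_lift[of 0 m v] v(1) by (simp add: l_def perp_zero Bq_def)
      then have c2: "cover_op (vecs (Suc m)) l =
          fscale (?q * (qnum ?q j - qnum ?q k)) l + fscale (?q ^ m) v"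
        unfolding v(3) chi_lift_scale using j by (simp add: l_def)
      \<comment> \<open>Both sides are the next q-number, built by adding the top power or by
        shifting.\<close>
      have shift: "qnum ?q i + ?q ^ i = 1 + ?q * qnum ?q i" for i
        using qnum_Suc[of ?q i] qnum_Suc_shift[of ?q i] by simp
      from \<alpha> show ?thesis
      proof
        assume \<alpha>: "\<alpha> = \<beta> @ [Ent0]"
        have N: "Nnz \<alpha> = k" "Suc m - k = Suc j" using j by (simp_all add: \<alpha> Nnz_snoc k_def)
        have eq: "vvec (Suc m) \<alpha> = fscale (?q ^ k) v + l"
          unfolding \<alpha> vvec_Ent0[OF \<beta>] by (simp add: v_def l_def k_def)
        have "cover_op (vecs (Suc m)) (fscale (?q ^ k) v + l) =
            fscale (?q ^ k) (fscale (qnum ?q j - qnum ?q k) v + l) +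
              (fscale (?q * (qnum ?q j - qnum ?q k)) l + fscale (?q ^ m) v)"
          by (simp only: cover_op_add cover_op_scale c1 c2)
        also have "\<dots> = fscale (?q ^ k * (qnum ?q j - qnum ?q k) + ?q ^ (k + j)) v +
            fscale (?q ^ k + ?q * (qnum ?q j - qnum ?q k)) l"
          by (simp add: fun_eq_iff fscale_apply j algebra_simps)
        also have "?q ^ k * (qnum ?q j - qnum ?q k) + ?q ^ (k + j) =
            (qnum ?q (Suc j) - qnum ?q k) * ?q ^ k"
          by (simp add: qnum_Suc power_add algebra_simps)
        also have "?q ^ k + ?q * (qnum ?q j - qnum ?q k) = qnum ?q (Suc j) - qnum ?q k"
          using shift[of k] by (simp add: qnum_Suc_shift algebra_simps)
        also have "fscale ((qnum ?q (Suc j) - qnum ?q k) * ?q ^ k) v + fscale (qnum ?q (Suc j) - qnum ?q k) l =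
            fscale (qnum ?q (Suc j) - qnum ?q k) (fscale (?q ^ k) v + l)"
          by (simp add: fun_eq_iff fscale_apply algebra_simps)
        finally have "cover_op (vecs (Suc m)) (vvec (Suc m) \<alpha>) =
            fscale (qnum ?q (Suc j) - qnum ?q k) (vvec (Suc m) \<alpha>)"
          unfolding eq .
        moreover have "vvec (Suc m) \<alpha> \<in> free_space (Bq (Suc m))"
          unfolding eq l_def by (intro free v)
        ultimately show ?thesis using N v(2) by simp
      next
        assume \<alpha>: "\<alpha> = \<beta> @ [Ent1]"
        have N: "Nnz \<alpha> = Suc k" "m - k = j" using j by (simp_all add: \<alpha> Nnz_snoc k_def)
        \<comment> \<open>The difference is rewritten so that additivity and homogeneity of
          \<open>cover_op\<close> suffice.\<close>
        have eq: "vvec (Suc m) \<alpha> = fscale (?q ^ j) v + fscale (- 1) l"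
          unfolding \<alpha> vvec_Ent1[OF \<beta>] using j by (simp add: v_def l_def k_def)
        have "cover_op (vecs (Suc m)) (fscale (?q ^ j) v + fscale (- 1) l) =
            fscale (?q ^ j) (fscale (qnum ?q j - qnum ?q k) v + l) +
              fscale (- 1) (fscale (?q * (qnum ?q j - qnum ?q k)) l + fscale (?q ^ m) v)"
          by (simp only: cover_op_add cover_op_scale c1 c2)
        also have "\<dots> = fscale (?q ^ j * (qnum ?q j - qnum ?q k) - ?q ^ (k + j)) v +
            fscale (?q ^ j - ?q * (qnum ?q j - qnum ?q k)) l"
          by (simp add: fun_eq_iff fscale_apply j algebra_simps)
        also have "?q ^ j * (qnum ?q j - qnum ?q k) - ?q ^ (k + j) =
            (qnum ?q j - qnum ?q (Suc k)) * ?q ^ j"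
          by (simp add: qnum_Suc power_add algebra_simps)
        also have "?q ^ j - ?q * (qnum ?q j - qnum ?q k) = - (qnum ?q j - qnum ?q (Suc k))"
          using shift[of j] by (simp add: qnum_Suc_shift algebra_simps)
        also have "fscale ((qnum ?q j - qnum ?q (Suc k)) * ?q ^ j) v + fscale (- (qnum ?q j - qnum ?q (Suc k))) l =
            fscale (qnum ?q j - qnum ?q (Suc k)) (fscale (?q ^ j) v + fscale (- 1) l)"
          by (simp add: fun_eq_iff fscale_apply algebra_simps)
        finally have "cover_op (vecs (Suc m)) (vvec (Suc m) \<alpha>) =
            fscale (qnum ?q j - qnum ?q (Suc k)) (vvec (Suc m) \<alpha>)"
          unfolding eq .
        moreover have "vvec (Suc m) \<alpha> \<in> free_space (Bq (Suc m))"
          unfolding eq l_def by (intro free v)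
        ultimately show ?thesis using N v(2) by simp
      qed
    qed
    have entchi: "vvec (Suc m) \<alpha> \<in> free_space (Bq (Suc m)) \<and> Nnz \<alpha> \<le> Suc m \<and>
      cover_op (vecs (Suc m)) (vvec (Suc m) \<alpha>) =
        fscale (qnum ?q (Suc m - Nnz \<alpha>) - qnum ?q (Nnz \<alpha>)) (vvec (Suc m) \<alpha>)"
      if \<beta>: "\<beta> \<in> Eq (m - 1)" and u: "u \<in> vecs m" "u \<noteq> 0" and \<alpha>: "\<alpha> = \<beta> @ [EntChi (chi m u)]" for \<alpha> \<beta> :: "'a entry list" and u
    proof -
      have "m \<noteq> 0" using u by (auto simp: vecs_0)
      then obtain p where p: "m = Suc p" using not0_implies_Suc by blast
      interpret iso: vecs_iso "m - 1" m "tau m (perp m u)" "perp m u" by (rule vecs_iso_tau[OF u])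
      define k where "k = Nnz \<beta>"
      define v where "v = vvec p \<beta>"
      have v: "v \<in> free_space (Bq p)" "k \<le> p"
          "cover_op (vecs p) v = fscale (qnum ?q (p - k) - qnum ?q k) v"
        using less[of p] \<beta> by (auto simp: v_def k_def Suc p)
      let ?w = "mu m (perp m u) v"
      have eq: "vvec (Suc m) \<alpha> = chi_lift m u ?w"
        unfolding \<alpha> vvec_EntChi[OF u] by (simp add: v_def p)
      have "cover_op (perp m u) ?w = fscale (qnum ?q (p - k) - qnum ?q k) ?w"
      proof -
        have "cover_op (perp m u) ?w = mu m (perp m u) (cover_op (vecs (m - 1)) v)"
          unfolding mu_eq_push[OF u] by (rule iso.cover_op_push)
        also have "cover_op (vecs (m - 1)) v = fscale (qnum ?q (p - k) - qnum ?q k) v"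
          using v(3) by (simp only: p diff_Suc_1)
        finally show ?thesis by (simp only: mu_scale)
      qed
      then have "cover_op (vecs (Suc m)) (vvec (Suc m) \<alpha>) =
          fscale (?q * (qnum ?q (p - k) - qnum ?q k)) (vvec (Suc m) \<alpha>)"
        unfolding eq using cover_op_chi_lift[OF u(1) mu_free_space[OF u], of v] u(2)
        by (simp add: chi_lift_scale)
      \<comment> \<open>Shifting each q-number adds a leading 1, and the two ones cancel.\<close>
      also have "?q * (qnum ?q (p - k) - qnum ?q k) = qnum ?q (Suc (p - k)) - qnum ?q (Suc k)"
        by (simp add: qnum_Suc_shift algebra_simps)
      also have "Suc (p - k) = Suc m - Suc k" using v(2) p by simp
      also have "Suc k = Nnz \<alpha>" by (simp add: \<alpha> Nnz_snoc k_def)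
      finally have "cover_op (vecs (Suc m)) (vvec (Suc m) \<alpha>) =
          fscale (qnum ?q (Suc m - Nnz \<alpha>) - qnum ?q (Nnz \<alpha>)) (vvec (Suc m) \<alpha>)" .
      moreover have "vvec (Suc m) \<alpha> \<in> free_space (Bq (Suc m))"
        unfolding eq by (rule free_space_Bq_Suc)
      moreover have "Nnz \<alpha> \<le> Suc m" using v(2) p by (simp add: \<alpha> Nnz_snoc k_def)
      ultimately show ?thesis by blast
    qed
    show ?thesis
      unfolding Suc
    proof
      fix \<alpha> :: "'a entry list" assume "\<alpha> \<in> Eq (Suc m)"
      then consider \<beta> where "\<beta> \<in> Eq m" "\<alpha> = \<beta> @ [Ent0] \<or> \<alpha> = \<beta> @ [Ent1]"
        | \<beta> u where "\<beta> \<in> Eq (m - 1)" "u \<in> vecs m" "u \<noteq> 0" "\<alpha> = \<beta> @ [EntChi (chi m u)]"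
        unfolding Eq_Suc by blast
      then show "vvec (Suc m) \<alpha> \<in> free_space (Bq (Suc m)) \<and> Nnz \<alpha> \<le> Suc m \<and>
        cover_op (vecs (Suc m)) (vvec (Suc m) \<alpha>) =
          fscale (qnum ?q (Suc m - Nnz \<alpha>) - qnum ?q (Nnz \<alpha>)) (vvec (Suc m) \<alpha>)"
        by cases (rule ent entchi, assumption+)+
    qed
  qed
qed

section \<open>Spanning and linear independence\<close>

text \<open>Fourier inversion: weighting \<open>char_sum n u Z\<close> by
  \<open>\<psi> (dot n u a)\<close> and summing over \<open>u\<close> isolates the single extension
  with representative \<open>a\<close>, up to the factor q^n. Each \<open>char_sum\<close> is zero
  or a multiple of a lift.\<close>

lemma free_space_Suc_subset:
  fixes V :: "('a fvec set \<Rightarrow> complex) set"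
  assumes V: "fs.subspace V" and base: "free_space (Bq n) \<subseteq> V"
    and lift: "\<And>u c. u \<in> vecs n \<Longrightarrow> c \<in> free_space (subspaces_of (perp n u)) \<Longrightarrow> chi_lift n u c \<in> V"
  shows "free_space (Bq (Suc n)) \<subseteq> V"
proof
  fix f :: "'a fvec set \<Rightarrow> complex" assume f: "f \<in> free_space (Bq (Suc n))"
  have basis: "basis_vec Y \<in> V" if "Y \<in> Bq (Suc n)" for Y
  proof (cases "Y \<in> Bq n")
    case True
    then show ?thesis by (intro subsetD[OF base] basis_vec_free_space)
  next
    case False
    then have "Y \<in> Aff n" using that Bq_Suc[where 'a = 'a, of n] by simp
    then obtain Z a where Z: "Z \<in> Bq n" and a: "a \<in> vecs n" and Y: "Y = affine_ext n Z a"
      by (rule Aff_cases)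
    have "(\<Sum>u\<in>vecs n. fscale (\<psi> (dot n u a)) (char_sum n u Z)) = fscale (of_nat (CARD('a) ^ n)) (basis_vec Y)"
    proof
      fix W :: "'a fvec set"
      have "(\<Sum>u\<in>vecs n. fscale (\<psi> (dot n u a)) (char_sum n u Z)) W =
          (\<Sum>u\<in>vecs n. \<Sum>c\<in>vecs n. \<psi> (- dot n u (c - a)) * basis_vec (affine_ext n Z c) W)"
        unfolding sum_fun_apply char_sum_def fscale_apply sum_distrib_left
        by (intro sum.cong refl) (simp add: dot_diff char_add[symmetric] mult.assoc[symmetric])
      also have "\<dots> = (\<Sum>c\<in>vecs n. (\<Sum>u\<in>vecs n. \<psi> (- dot n u (c - a))) * basis_vec (affine_ext n Z c) W)"
        unfolding sum_distrib_right by (rule sum.swap)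
      also have "\<dots> = (\<Sum>c\<in>vecs n. if c = a then of_nat (CARD('a) ^ n) * basis_vec (affine_ext n Z a) W else 0)"
        using a by (intro sum.cong refl) (simp add: sum_char_vecs vecs_diff)
      also have "\<dots> = fscale (of_nat (CARD('a) ^ n)) (basis_vec Y) W"
        using a by (simp add: Y fscale_apply)
      finally show "(\<Sum>u\<in>vecs n. fscale (\<psi> (dot n u a)) (char_sum n u Z)) W =
        fscale (of_nat (CARD('a) ^ n)) (basis_vec Y) W" .
    qed
    moreover have "char_sum n u Z \<in> V" if "u \<in> vecs n" for u
    proof (cases "Z \<subseteq> perp n u")
      case True
      then have "chi_lift n u (basis_vec Z) \<in> V"
        using Z that by (intro lift basis_vec_free_space) (auto simp: subspaces_of_iff_Bq[OF perp_in_Bq])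
      then show ?thesis using True fs.subspace_scale[OF V] by (simp add: char_sum_eq[OF Z])
    next
      case False
      then show ?thesis using fs.subspace_0[OF V] by (simp only: char_sum_eq[OF Z] if_False)
    qed
    ultimately have "fscale (of_nat (CARD('a) ^ n)) (basis_vec Y) \<in> V"
      by (metis (no_types, lifting) V fs.subspace_scale fs.subspace_sum)
    then have "fscale (1 / of_nat (CARD('a) ^ n)) (fscale (of_nat (CARD('a) ^ n)) (basis_vec Y)) \<in> V"
      by (rule fs.subspace_scale[OF V])
    then show ?thesis by simp
  qed
  have "(\<Sum>Y\<in>Bq (Suc n). fscale (f Y) (basis_vec Y)) \<in> V"
    using basis by (intro fs.subspace_sum[OF V] fs.subspace_scale[OF V])
  then show "f \<in> V"
    using free_space_expansion[OF finite_Bq f] by simp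
qed

text \<open>Lifts vanish on subspaces of \<open>vecs n\<close>, which gives \<open>a = 0\<close>.
  For fixed \<open>Z\<close>, the values at its extensions form the Fourier transform of
  \<open>w \<mapsto> c w Z\<close>, and inversion in \<open>b\<close> recovers each
  \<open>c u Z\<close>.\<close>

lemma decomposition_unique:
  assumes a: "a \<in> free_space (Bq n)"
    and c: "\<And>u. u \<in> vecs n \<Longrightarrow> c u \<in> free_space (subspaces_of (perp n u))"
    and zero: "a + (\<Sum>u\<in>vecs n. chi_lift n u (c u)) = 0"
  shows "a = 0" and "u \<in> vecs n \<Longrightarrow> c u = 0"
proof -
  have zero': "a W + (\<Sum>u\<in>vecs n. chi_lift n u (c u) W) = 0" for W
    using fun_cong[OF zero, of W] by (simp add: sum_fun_apply)
  show "a = 0"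
  proof
    fix W show "a W = 0 W"
    proof (cases "W \<in> Bq n")
      case True
      then have "W \<notin> Aff n" using Bq_Int_Aff by blast
      then show ?thesis using zero'[of W] by (simp add: chi_lift_outside)
    next
      case False
      then show ?thesis using a by (simp add: free_space_iff)
    qed
  qed
  assume u: "u \<in> vecs n"
  show "c u = 0"
  proof
    fix Z show "c u Z = 0 Z"
    proof (cases "Z \<in> Bq n")
      case True
      have z: "(\<Sum>w\<in>vecs n. \<psi> (- dot n w b) * c w Z) = 0" if b: "b \<in> vecs n" for b
      proof -
        have "(\<Sum>w\<in>vecs n. \<psi> (- dot n w b) * c w Z) = (\<Sum>w\<in>vecs n. chi_lift n w (c w) (affine_ext n Z b))"
          by (rule sum.cong) (auto simp: chi_lift_affine_ext[OF c True b])
        then show ?thesis using zero'[of "affine_ext n Z b"] \<open>a = 0\<close> by simp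
      qed
      have sw: "\<psi> (dot n u b) * \<psi> (- dot n w b) = \<psi> (- dot n b (w - u))" for b w
        by (simp add: char_add[symmetric] dot_diff dot_commute[of n b])
      have "0 = (\<Sum>b\<in>vecs n. \<psi> (dot n u b) * (\<Sum>w\<in>vecs n. \<psi> (- dot n w b) * c w Z))"
        by (rule sum.neutral[symmetric]) (simp add: z)
      also have "\<dots> = (\<Sum>b\<in>vecs n. \<Sum>w\<in>vecs n. \<psi> (- dot n b (w - u)) * c w Z)"
        unfolding sum_distrib_left by (intro sum.cong refl) (simp add: sw mult.assoc[symmetric])
      also have "\<dots> = (\<Sum>w\<in>vecs n. (\<Sum>b\<in>vecs n. \<psi> (- dot n b (w - u))) * c w Z)"
        unfolding sum_distrib_right by (rule sum.swap)
      also have "\<dots> = (\<Sum>w\<in>vecs n. if w = u then of_nat (CARD('a) ^ n) * c u Z else 0)"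
        using u by (intro sum.cong refl) (simp add: sum_char_vecs vecs_diff)
      also have "\<dots> = of_nat (CARD('a) ^ n) * c u Z"
        using u by simp
      finally show ?thesis by simp
    next
      case False
      then have "Z \<notin> subspaces_of (perp n u)" by (simp add: subspaces_of_iff_Bq[OF perp_in_Bq])
      then show ?thesis
        using c[OF u] free_space_iff[OF finite_subspaces_of[OF perp_subset_vecs]] by (metis zero_fun_apply)
    qed
  qed
qed

text \<open>The entries 0 and 1 give back \<open>vvec m \<beta>\<close> and its lift, as the two
  equations are invertible. The characters give all other lifts, because \<open>mu\<close> maps onto
  the functions on subspaces of the hyperplane.\<close>

lemma span_vvec: "free_space (Bq n) \<subseteq> fs.span (vvec n ` (Eq n :: 'a entry list set))"
proof (induction n rule: less_induct)
  case (less n)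
  show ?case
  proof (cases n)
    case 0
    show ?thesis
    proof
      fix f :: "'a fvec set \<Rightarrow> complex" assume "f \<in> free_space (Bq n)"
      then have "f = fscale (f {0}) (basis_vec {0})"
        using free_space_expansion[of "Bq 0" f] by (simp add: 0 Bq_0)
      also have "\<dots> \<in> fs.span (vvec n ` Eq n)"
        by (intro fs.span_scale fs.span_base) (simp add: 0)
      finally show "f \<in> fs.span (vvec n ` Eq n)" .
    qed
  next
    case (Suc m)
    let ?q = "of_nat CARD('a) :: complex"
    let ?V = "fs.span (vvec (Suc m) ` (Eq (Suc m) :: 'a entry list set))"
    have V: "fs.subspace ?V" by (rule fs.subspace_span)
    have mem: "vvec (Suc m) \<alpha> \<in> ?V" if "\<alpha> \<in> Eq (Suc m)" for \<alpha> :: "'a entry list"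
      using that by (intro fs.span_base) simp
    have gen: "vvec m \<beta> \<in> ?V \<and> chi_lift m 0 (vvec m \<beta>) \<in> ?V" if \<beta>: "\<beta> \<in> Eq m" for \<beta> :: "'a entry list"
    proof -
      define s t where "s = ?q ^ Nnz \<beta>" and "t = ?q ^ (m - Nnz \<beta>)"
      \<comment> \<open>As the image of a natural number the determinant is nonzero by
        positivity.\<close>
      have "s + t = of_nat (CARD('a) ^ Nnz \<beta> + CARD('a) ^ (m - Nnz \<beta>))"
        by (simp add: s_def t_def)
      then have st: "s + t \<noteq> 0" by (simp only: of_nat_eq_0_iff) simp
      have v0: "fscale s (vvec m \<beta>) + chi_lift m 0 (vvec m \<beta>) \<in> ?V"
        using mem[of "\<beta> @ [Ent0]"] \<beta> by (simp add: vvec_Ent0 Eq_Suc s_def)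
      have v1: "fscale t (vvec m \<beta>) - chi_lift m 0 (vvec m \<beta>) \<in> ?V"
        using mem[of "\<beta> @ [Ent1]"] \<beta> by (simp add: vvec_Ent1 Eq_Suc t_def)
      have "fscale (1 / (s + t)) (fscale s (vvec m \<beta>) + chi_lift m 0 (vvec m \<beta>) +
          (fscale t (vvec m \<beta>) - chi_lift m 0 (vvec m \<beta>))) \<in> ?V"
        by (intro fs.span_scale fs.span_add[OF v0 v1])
      moreover have "fscale s (vvec m \<beta>) + chi_lift m 0 (vvec m \<beta>) +
          (fscale t (vvec m \<beta>) - chi_lift m 0 (vvec m \<beta>)) = fscale (s + t) (vvec m \<beta>)"
        by (simp add: fs.scale_left_distrib)
      ultimately have v: "vvec m \<beta> \<in> ?V" using st by simp
      have "fscale s (vvec m \<beta>) + chi_lift m 0 (vvec m \<beta>) - fscale s (vvec m \<beta>) \<in> ?V"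
        by (intro fs.span_diff v0 fs.span_scale v)
      then show ?thesis using v by simp
    qed
    have IH: "free_space (Bq m) \<subseteq> fs.span (vvec m ` (Eq m :: 'a entry list set))"
      using less Suc by simp
    have "free_space (Bq (Suc m)) \<subseteq> ?V"
    proof (rule free_space_Suc_subset[OF V])
      have "fs.span (vvec m ` (Eq m :: 'a entry list set)) \<subseteq> ?V"
        by (intro fs.span_minimal V) (auto simp: gen)
      then show "free_space (Bq m) \<subseteq> ?V" using IH by blast
    next
      fix u :: "'a fvec" and c :: "'a fvec set \<Rightarrow> complex"
      assume u: "u \<in> vecs m" and c: "c \<in> free_space (subspaces_of (perp m u))"
      show "chi_lift m u c \<in> ?V"
      proof (cases "u = 0")
        case True
        have "fs.subspace {f. chi_lift m 0 f \<in> ?V}"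
          unfolding fs.subspace_def
          by (auto simp: chi_lift_add chi_lift_scale chi_lift_zero fs.span_zero intro: fs.span_add fs.span_scale)
        then have "fs.span (vvec m ` (Eq m :: 'a entry list set)) \<subseteq> {f. chi_lift m 0 f \<in> ?V}"
          by (intro fs.span_minimal) (auto simp: gen)
        moreover have "c \<in> free_space (Bq m)" using c True by (simp add: perp_zero Bq_def)
        ultimately show ?thesis using IH True by blast
      next
        case False
        then have "m \<noteq> 0" using u by (auto simp: vecs_0)
        have "fs.subspace {f. chi_lift m u (mu m (perp m u) f) \<in> ?V}"
          unfolding fs.subspace_def
          by (auto simp: chi_lift_add chi_lift_scale chi_lift_zero mu_add mu_scale mu_zero fs.span_zero
              intro: fs.span_add fs.span_scale)
        moreover have "chi_lift m u (mu m (perp m u) (vvec (m - 1) \<beta>)) \<in> ?V" if "\<beta> \<in> Eq (m - 1)" for \<beta>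
        proof -
          have "\<beta> @ [EntChi (chi m u)] \<in> Eq (Suc m)"
            unfolding Eq_Suc using that u False by blast
          from mem[OF this] show ?thesis unfolding vvec_EntChi[OF u False] .
        qed
        ultimately have *: "fs.span (vvec (m - 1) ` (Eq (m - 1) :: 'a entry list set)) \<subseteq>
            {f. chi_lift m u (mu m (perp m u) f) \<in> ?V}"
          by (intro fs.span_minimal) auto
        obtain f where f: "f \<in> free_space (Bq (m - 1))" "mu m (perp m u) f = c"
          using vecs_iso.push_surj[OF vecs_iso_tau[OF u False] c] by (metis mu_eq_push[OF u False])
        have "m - 1 < n" using Suc by simp
        then show ?thesis using less[of "m - 1"] * f by blast
      qed
    qed
    then show ?thesis by (simp add: Suc)
  qed
qed

lemma free_space_sum_vvec:
  "(\<Sum>\<beta>\<in>(Eq n :: 'a entry list set). fscale (x \<beta>) (vvec n \<beta>)) \<in> free_space (Bq n)"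
  using vvec_eigenvector[of n]
  by (intro fs.subspace_sum[OF subspace_free_space] fs.subspace_scale[OF subspace_free_space]) auto

text \<open>Stated with coefficients on sequences instead of vectors, which gives injectivity of
  \<open>vvec n\<close> together with independence.\<close>

lemma vvec_coefficients_zero:
  fixes x :: "'a entry list \<Rightarrow> complex"
  assumes "(\<Sum>\<alpha>\<in>Eq n. fscale (x \<alpha>) (vvec n \<alpha>)) = 0" "\<alpha> \<in> Eq n"
  shows "x \<alpha> = 0"
  using assms
proof (induction n arbitrary: x \<alpha> rule: less_induct)
  case (less n)
  show ?case
  proof (cases n)
    case 0
    then have "fscale (x \<alpha>) (basis_vec {0 :: 'a fvec}) = (\<lambda>_. 0)"
      using less.prems by simp
    from fun_cong[OF this, of "{0}"] show ?thesis
      by (simp add: basis_vec_def fscale_apply)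
  next
    case (Suc m)
    let ?q = "of_nat CARD('a) :: complex"
    \<comment> \<open>The vanishing combination is sorted by components: \<open>A\<close> is the
      part on subspaces of \<open>vecs m\<close>, \<open>B\<close> the input of the untwisted lift
      and \<open>C u\<close> that of the character for \<open>u\<close>. The family \<open>c\<close>
      joins the last two, with \<open>B\<close> at \<open>u = 0\<close>.\<close>
    define A where "A = (\<Sum>\<beta>\<in>Eq m. fscale (x (\<beta> @ [Ent0]) * ?q ^ Nnz \<beta> +
      x (\<beta> @ [Ent1]) * ?q ^ (m - Nnz \<beta>)) (vvec m \<beta>))"
    define B where "B = (\<Sum>\<beta>\<in>Eq m. fscale (x (\<beta> @ [Ent0]) - x (\<beta> @ [Ent1])) (vvec m \<beta>))"
    define C where "C u = (\<Sum>\<beta>\<in>Eq (m - 1). fscale (x (\<beta> @ [EntChi (chi m u)])) (vvec (m - 1) \<beta>))" for u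
    define c where "c u = (if u = 0 then B else mu m (perp m u) (C u))" for u
    have A: "A \<in> free_space (Bq m)" and B: "B \<in> free_space (Bq m)"
      and C: "C u \<in> free_space (Bq (m - 1))" for u
      unfolding A_def B_def C_def by (rule free_space_sum_vvec)+
    have c: "c u \<in> free_space (subspaces_of (perp m u))" if "u \<in> vecs m" for u
      using B mu_free_space[OF that] by (simp add: c_def perp_zero Bq_def)
    have AB: "(\<Sum>\<beta>\<in>Eq m. fscale (x (\<beta> @ [Ent0])) (vvec (Suc m) (\<beta> @ [Ent0]))) +
        (\<Sum>\<beta>\<in>Eq m. fscale (x (\<beta> @ [Ent1])) (vvec (Suc m) (\<beta> @ [Ent1]))) = A + chi_lift m 0 B"
      unfolding A_def B_def chi_lift_sum sum.distrib[symmetric]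
      by (rule sum.cong[OF refl], simp only: vvec_Ent0 vvec_Ent1 chi_lift_scale)
         (simp add: fun_eq_iff fscale_apply algebra_simps)
    have CC: "(\<Sum>\<beta>\<in>Eq (m - 1). fscale (x (\<beta> @ [EntChi (chi m u)])) (vvec (Suc m) (\<beta> @ [EntChi (chi m u)]))) =
        chi_lift m u (c u)" if u: "u \<in> vecs m - {0}" for u
      using u by (simp add: c_def C_def mu_sum mu_scale chi_lift_sum chi_lift_scale vvec_EntChi)
    have "0 = A + chi_lift m 0 B + (\<Sum>u\<in>vecs m - {0}. chi_lift m u (c u))"
      using less.prems(1) by (simp only: Suc sum_Eq_Suc AB CC cong: sum.cong)
    also have "\<dots> = A + (\<Sum>u\<in>vecs m. chi_lift m u (c u))"
      by (subst (2) sum.remove[of _ 0]) (simp_all add: c_def add.assoc)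
    finally have zero: "A + (\<Sum>u\<in>vecs m. chi_lift m u (c u)) = 0" by simp
    have A0: "A = 0" and c0: "\<And>u. u \<in> vecs m \<Longrightarrow> c u = 0"
      using decomposition_unique[OF A c zero] by blast+
    have B0: "B = 0" using c0[of 0] by (simp add: c_def)
    have C0: "C u = 0" if "u \<in> vecs m" "u \<noteq> 0" for u
    proof (rule vecs_iso.push_eq_0[OF vecs_iso_tau[OF that] C])
      show "vecs_iso.push (m - 1) (tau m (perp m u)) (C u) = 0"
        using c0[OF that(1)] that by (simp add: c_def mu_eq_push)
    qed
    from less.prems(2) consider \<beta> where "\<beta> \<in> Eq m" "\<alpha> = \<beta> @ [Ent0] \<or> \<alpha> = \<beta> @ [Ent1]"
      | \<beta> u where "\<beta> \<in> Eq (m - 1)" "u \<in> vecs m" "u \<noteq> 0" "\<alpha> = \<beta> @ [EntChi (chi m u)]"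
      unfolding Suc Eq_Suc by blast
    then show ?thesis
    proof cases
      case 1
      have e1: "x (\<beta> @ [Ent0]) * ?q ^ Nnz \<beta> + x (\<beta> @ [Ent1]) * ?q ^ (m - Nnz \<beta>) = 0"
        by (rule less.IH[of m _ \<beta>]) (use A0 1 in \<open>simp_all add: Suc A_def\<close>)
      have e2: "x (\<beta> @ [Ent0]) - x (\<beta> @ [Ent1]) = 0"
        by (rule less.IH[of m _ \<beta>]) (use B0 1 in \<open>simp_all add: Suc B_def\<close>)
      \<comment> \<open>\<open>e1\<close> and \<open>e2\<close> form a linear system for the two
        coefficients; up to sign its determinant is this positive integer.\<close>
      have "x (\<beta> @ [Ent0]) * of_nat (CARD('a) ^ Nnz \<beta> + CARD('a) ^ (m - Nnz \<beta>)) = 0"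
        using e1 e2 by (simp add: algebra_simps)
      then have "x (\<beta> @ [Ent0]) = 0" by (simp only: mult_eq_0_iff of_nat_eq_0_iff) simp
      then show ?thesis using e2 1 by auto
    next
      case 2
      have "m - 1 < n" using Suc by simp
      then show ?thesis
        unfolding 2(4)
        by (rule less.IH[where x = "\<lambda>\<beta>. x (\<beta> @ [EntChi (chi m u)])", OF _ C0[OF 2(2,3), unfolded C_def] 2(1)])
    qed
  qed
qed

end

theorem theorem4p3:
  fixes n :: nat
  shows "(\<forall>\<alpha> \<in> (Eq n :: 'a::{field,finite} entry list set).
            vvec n \<alpha> \<in> free_space (Bq n) \<and>
            Aop n (vvec n \<alpha>) =
              fscale (qnum (of_nat CARD('a)) (n - Nnz \<alpha>) - qnum (of_nat CARD('a)) (Nnz \<alpha>))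
                (vvec n \<alpha>)) \<and>
         (inj_on (vvec n) (Eq n :: 'a entry list set) \<and>
          fs.independent (vvec n ` (Eq n :: 'a entry list set)) \<and>
          fs.span (vvec n ` (Eq n :: 'a entry list set)) = free_space (Bq n))"
proof -
  obtain \<psi> :: "'a \<Rightarrow> complex" where "nontrivial_char \<psi>"
    using nontrivial_char_exists by blast
  then interpret nontrivial_char \<psi> .
  let ?E = "Eq n :: 'a entry list set"
  have eigen: "\<forall>\<alpha>\<in>?E. vvec n \<alpha> \<in> free_space (Bq n) \<and> Aop n (vvec n \<alpha>) =
      fscale (qnum (of_nat CARD('a)) (n - Nnz \<alpha>) - qnum (of_nat CARD('a)) (Nnz \<alpha>)) (vvec n \<alpha>)"
    using vvec_eigenvector[of n] by (simp add: Aop_eq_cover_op)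
  have inj: "inj_on (vvec n) ?E"
  proof (rule inj_onI, rule ccontr)
    fix \<alpha> \<beta> :: "'a entry list"
    assume *: "\<alpha> \<in> ?E" "\<beta> \<in> ?E" "vvec n \<alpha> = vvec n \<beta>" "\<alpha> \<noteq> \<beta>"
    \<comment> \<open>Two equal vectors with different indices would satisfy a relation with
      coefficients 1 and -1.\<close>
    let ?x = "\<lambda>\<gamma>. if \<gamma> = \<alpha> then 1 else if \<gamma> = \<beta> then - 1 else (0 :: complex)"
    have "(\<Sum>\<gamma>\<in>?E. fscale (?x \<gamma>) (vvec n \<gamma>)) = (\<Sum>\<gamma>\<in>{\<alpha>, \<beta>}. fscale (?x \<gamma>) (vvec n \<gamma>))"
      using * by (intro sum.mono_neutral_right finite_Eq) auto
    also have "\<dots> = 0" using * by simp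
    finally have "?x \<alpha> = 0" using *(1) by (rule vvec_coefficients_zero)
    then show False by simp
  qed
  have "fs.independent (vvec n ` ?E)"
  proof
    assume "fs.dependent (vvec n ` ?E)"
    then obtain y where y: "\<exists>v\<in>vvec n ` ?E. y v \<noteq> 0" "(\<Sum>v\<in>vvec n ` ?E. fscale (y v) v) = 0"
      unfolding fs.dependent_finite[OF finite_imageI[OF finite_Eq]] by blast
    have "(\<Sum>\<alpha>\<in>?E. fscale (y (vvec n \<alpha>)) (vvec n \<alpha>)) = 0"
      using y(2) by (simp add: sum.reindex[OF inj])
    from vvec_coefficients_zero[OF this] show False using y(1) by auto
  qed
  moreover have "fs.span (vvec n ` ?E) = free_space (Bq n)"
    using span_vvec[of n] eigen
    by (intro subset_antisym fs.span_minimal subspace_free_space) auto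
  ultimately show ?thesis using eigen inj by blast
qed

end
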